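(* Let $\mathcal T$ be a self-similar tiling in $\mathbb R^d$ with (single) generator $G\subseteq\mathbb R^d$ of inradius $g$. Assume that $G$ is monophase, with $V(G,\varepsilon)=\sum_{k=0}^d\kappa_k(G)\varepsilon^{d-k}$ for $0<\varepsilon\le g$, and that the poles of the tubular zeta function $\zeta_{\mathcal T}$ are simple (which implies that $\mathcal D_{\mathcal L}$ and $\{0,1,\dots,d\}$ are disjoint). Then for all $0<\varepsilon<g$, $$V(\mathcal T,\varepsilon)=\sum_{\omega\in\mathcal D_{\mathcal L}}c_\omega\varepsilon^{d-\omega}+\sum_{k=0}^dc_k\varepsilon^{d-k}=\sum_{\omega\in\mathcal D_{\mathcal T}}c_\omega\varepsilon^{d-\omega},$$ where $$c_\omega:=\frac{\operatorname{Res}_{s=\omega}\zeta_{\mathcal L}(s)}{d-\omega}\sum_{k=0}^{d-1}\frac{g^{\omega-k}(d-k)}{\omega-k}\kappa_k(G)\quad(\omega\in\mathcal D_{\mathcal L}),\qquad c_k:=\kappa_k(G)\,\zeta_{\mathcal L}(k)\quad(k=0,1,\dots,d).$$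
   Context: Self-similar tilings. Let $\{\Phi_1,\dots,\Phi_N\}$, $N\ge2$, be contractive similarities of $\mathbb R^d$ with scaling ratios $r_n\in(0,1)$, $\Phi(A):=\bigcup_n\Phi_n(A)$, and $F$ the attractor (the unique nonempty compact set with $F=\Phi(F)$). A feasible open set is a nonempty open $O\subseteq\mathbb R^d$ (bounded here) with $\Phi_n(O)\subseteq O$ for all $n$ and $\Phi_n(O)\cap\Phi_m(O)=\emptyset$ for $n\ne m$; the open set condition says that one exists. The nontriviality condition says that $O\not\subseteq\Phi(\overline O)$ for some feasible $O$ (this does not depend on the choice of $O$). Both conditions are always assumed. The self-similar tiling associated with $\{\Phi_n\}$ and $O$ is $\mathcal T=\{\Phi_w(G_q)\}$, where the $G_q$ are the connected components of $O\setminus\Phi(\overline O)$ and $w=w_1\cdots w_n$ runs over all finite words (including the empty word) in $\{1,\dots,N\}$, with $\Phi_w=\Phi_{w_1}\circ\cdots\circ\Phi_{w_n}$, $r_w=r_{w_1}\cdots r_{w_n}$ ($\Phi_w=\mathrm{Id}$, $r_w=1$ for the empty word). Here there is a single component $G$ (the generator). The words are ordered as $w^{(1)},w^{(2)},\dots$ so that $\ell_j:=r_{w^{(j)}}$ is nonincreasing; $\mathcal L=\{\ell_j\}$ is the associated fractal string ($\ell_1=1$), and the tiles are $G^j=\Phi_{w^{(j)}}(G)$. Inner parallel volumes. $\lambda_d$ is Lebesgue measure. For bounded open $A\subseteq\mathbb R^d$ and $\varepsilon>0$, $A_{-\varepsilon}:=\{x\in A:\operatorname{dist}(x,A^c)\le\varepsilon\}$,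 $V(A,\varepsilon):=\lambda_d(A_{-\varepsilon})$, and $V(\mathcal T,\varepsilon):=\lambda_d(T_{-\varepsilon})=\sum_jV(G^j,\varepsilon)$ with $T=\bigcup_jG^j$. The inradius $g$ of $G$ is the radius of the largest open ball contained in $G$. Monophase. $G$ is monophase if there are constants $\kappa_0(G),\dots,\kappa_d(G)\in\mathbb R$ with $V(G,\varepsilon)=\sum_{k=0}^d\kappa_k(G)\varepsilon^{d-k}$ for $0<\varepsilon\le g$; one then takes $\kappa_k(G,\varepsilon):=\kappa_k(G)$ for all $\varepsilon>0$. Zeta functions. $\zeta_{\mathcal L}(s)=\sum_j\ell_j^s$ for $\Re s$ large, with meromorphic continuation $\zeta_{\mathcal L}(s)=1/(1-\sum_{n=1}^Nr_n^s)$ to $\mathbb C$. The tubular zeta function is (the meromorphic extension in $s$ to $\mathbb C$ of) $$\zeta_{\mathcal T}(\varepsilon,s)=\varepsilon^{d-s}\sum_{j=1}^\infty\ell_j^s\left(\sum_{k=0}^d\frac{g^{s-k}}{s-k}\kappa_k(G,\ell_j^{-1}\varepsilon)-\frac{g^{s-d}}{s-d}\lambda_d(G)\right).$$ $\mathcal D_{\mathcal L}$ is the set of poles of $\zeta_{\mathcal L}$ (the complex roots of $\sum_nr_n^s=1$). The set of (potential) poles of $\zeta_{\mathcal T}$ is $\mathcal D_{\mathcal T}:=\mathcal D_{\mathcal L}\cup\{0,1,\dots,d\}$; "the poles of $\zeta_{\mathcal T}$ are simple" is understood to mean that all poles of $\zeta_{\mathcal L}$ are simple and $\mathcal D_{\mathcal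 L}\cap\{0,1,\dots,d\}=\emptyset$. Convention. An infinite sum over complex dimensions is understood as $\lim_{n\to\infty}$ of the sums over those $\omega$ with $T_{-n}<\Im\omega<T_n$, where $\{T_n\}_{n\in\mathbb Z}$ is a real sequence with $T_{-n}<0<T_n$ ($n\ge1$), $T_n\to\infty$, $T_{-n}\to-\infty$, $T_n/|T_{-n}|\to1$, along which $\zeta_{\mathcal L}$ is languid of order $0$: for some $c>0$, $|\zeta_{\mathcal L}(\alpha+iT_n)|\le c$ for all $n$ and all $\alpha\in\mathbb R$ (such sequences exist for self-similar strings). *)

theory Defs
  imports "HOL-Complex_Analysis.Complex_Analysis"
begin

section \<open>Self-similar tilings\<close>

text \<open>The maps are \<open>\<Phi> 1, \<dots>, \<Phi> N\<close>; values of \<open>\<Phi>\<close> and \<open>r\<close> at other indices play no role.\<close>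

definition contractive_similarities ::
    "nat \<Rightarrow> (nat \<Rightarrow> 'a::euclidean_space \<Rightarrow> 'a) \<Rightarrow> (nat \<Rightarrow> real) \<Rightarrow> bool" where
  "contractive_similarities N \<Phi> r \<longleftrightarrow> N \<ge> 2 \<and>
     (\<forall>n\<in>{1..N}. 0 < r n \<and> r n < 1 \<and> (\<forall>x y. dist (\<Phi> n x) (\<Phi> n y) = r n * dist x y))"

definition ifs_image :: "nat \<Rightarrow> (nat \<Rightarrow> 'a \<Rightarrow> 'a) \<Rightarrow> 'a set \<Rightarrow> 'a set" where
  "ifs_image N \<Phi> A = (\<Union>n\<in>{1..N}. \<Phi> n ` A)"

definition feasible_open_set ::
    "nat \<Rightarrow> (nat \<Rightarrow> 'a::euclidean_space \<Rightarrow> 'a) \<Rightarrow> 'a set \<Rightarrow> bool" where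
  "feasible_open_set N \<Phi> U \<longleftrightarrow> U \<noteq> {} \<and> open U \<and> bounded U \<and>
     (\<forall>n\<in>{1..N}. \<Phi> n ` U \<subseteq> U) \<and>
     (\<forall>n\<in>{1..N}. \<forall>m\<in>{1..N}. n \<noteq> m \<longrightarrow> \<Phi> n ` U \<inter> \<Phi> m ` U = {})"

definition nontriviality_condition :: "nat \<Rightarrow> (nat \<Rightarrow> 'a::euclidean_space \<Rightarrow> 'a) \<Rightarrow> bool" where
  "nontriviality_condition N \<Phi> \<longleftrightarrow>
     (\<exists>U. feasible_open_set N \<Phi> U \<and> \<not> U \<subseteq> ifs_image N \<Phi> (closure U))"

definition generators :: "nat \<Rightarrow> (nat \<Rightarrow> 'a::euclidean_space \<Rightarrow> 'a) \<Rightarrow> 'a set \<Rightarrow> 'a set set" where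
  "generators N \<Phi> U = components (U - ifs_image N \<Phi> (closure U))"

abbreviation words :: "nat \<Rightarrow> nat list set" where
  "words N \<equiv> lists {1..N}"

fun word_map :: "(nat \<Rightarrow> 'a \<Rightarrow> 'a) \<Rightarrow> nat list \<Rightarrow> 'a \<Rightarrow> 'a" where
  "word_map \<Phi> [] = id"
| "word_map \<Phi> (n # w) = \<Phi> n \<circ> word_map \<Phi> w"

definition word_ratio :: "(nat \<Rightarrow> real) \<Rightarrow> nat list \<Rightarrow> real" where
  "word_ratio r w = prod_list (map r w)"

definition self_similar_tiling ::
    "nat \<Rightarrow> (nat \<Rightarrow> 'a::euclidean_space \<Rightarrow> 'a) \<Rightarrow> 'a set \<Rightarrow> 'a set set" where
  "self_similar_tiling N \<Phi> U =
     {word_map \<Phi> w ` G | w G. w \<in> words N \<and> G \<in> generators N \<Phi> U}"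


section \<open>Inner parallel volumes\<close>

definition inner_parallel_set :: "'a::euclidean_space set \<Rightarrow> real \<Rightarrow> 'a set" where
  "inner_parallel_set A \<epsilon> = {x \<in> A. infdist x (- A) \<le> \<epsilon>}"

definition inner_volume :: "'a::euclidean_space set \<Rightarrow> real \<Rightarrow> real" where
  "inner_volume A \<epsilon> = measure lebesgue (inner_parallel_set A \<epsilon>)"

definition tiling_volume :: "'a::euclidean_space set set \<Rightarrow> real \<Rightarrow> real" where
  "tiling_volume \<T> \<epsilon> = inner_volume (\<Union>\<T>) \<epsilon>"

text \<open>For a nonempty bounded open set the supremum is attained, so this is the radius of the
  largest open ball contained in it.\<close>

definition inradius :: "'a::euclidean_space set \<Rightarrow> real" where
  "inradius A = Sup {\<rho>. \<exists>x. ball x \<rho> \<subseteq> A}"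

definition monophase_with :: "'a::euclidean_space set \<Rightarrow> (nat \<Rightarrow> real) \<Rightarrow> bool" where
  "monophase_with G \<kappa> \<longleftrightarrow> (\<forall>\<epsilon>. 0 < \<epsilon> \<and> \<epsilon> \<le> inradius G \<longrightarrow>
     inner_volume G \<epsilon> = (\<Sum>k = 0..DIM('a). \<kappa> k * \<epsilon> ^ (DIM('a) - k)))"


section \<open>The scaling zeta function and the complex dimensions\<close>

text \<open>The meromorphic continuation of the Dirichlet series of the fractal string
  \<open>(word_ratio r w)\<close>, \<open>w \<in> words N\<close>; see \<open>string_zeta_has_sum\<close> and
  \<open>string_zeta_meromorphic\<close> below.  At a pole the term evaluates to \<open>0\<close>.\<close>

definition string_zeta :: "nat \<Rightarrow> (nat \<Rightarrow> real) \<Rightarrow> complex \<Rightarrow> complex" where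
  "string_zeta N r s = 1 / (1 - (\<Sum>n = 1..N. complex_of_real (r n) powr s))"

lemma word_ratio_pos:
  assumes "\<And>n. n \<in> {1..N} \<Longrightarrow> 0 < r n" "w \<in> words N"
  shows "0 < word_ratio r w"
  using assms(2,1) by (induction rule: lists.induct) (auto simp: word_ratio_def)

lemma word_ratio_powr_Cons:
  assumes "\<And>n. n \<in> {1..N} \<Longrightarrow> 0 < r n" "w \<in> words N" "n \<in> {1..N}"
  shows "complex_of_real (word_ratio r (n # w)) powr s =
           complex_of_real (r n) powr s * complex_of_real (word_ratio r w) powr s"
proof -
  have "0 < r n" "0 < word_ratio r w"
    using assms word_ratio_pos[of N r w] by auto
  then show ?thesis
    by (simp add: word_ratio_def powr_times_real_left)
qed

lemma words_Suc: "{w \<in> words N. length w \<le> Suc M} =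
    insert [] (\<Union>n\<in>{1..N}. (#) n ` {w \<in> words N. length w \<le> M})"
proof (rule set_eqI)
  fix w show "w \<in> {w \<in> words N. length w \<le> Suc M} \<longleftrightarrow>
      w \<in> insert [] (\<Union>n\<in>{1..N}. (#) n ` {w \<in> words N. length w \<le> M})"
    by (cases w) auto
qed

lemma words_unfold: "words N = insert [] (\<Union>n\<in>{1..N}. (#) n ` words N)"
proof (rule set_eqI)
  fix w show "w \<in> words N \<longleftrightarrow> w \<in> insert [] (\<Union>n\<in>{1..N}. (#) n ` words N)"
    by (cases w) auto
qed

lemma finite_words_le: "finite {w \<in> words N. length w \<le> M}"
proof -
  have "{w \<in> words N. length w \<le> M} = {w. set w \<subseteq> {1..N} \<and> length w \<le> M}"
    by (auto simp: lists_eq_set)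
  then show ?thesis by (simp add: finite_lists_length_le)
qed

text \<open>The hypothesis on \<open>Re s\<close> holds for all sufficiently large \<open>Re s\<close>, since each ratio
  is in \<open>(0,1)\<close>.\<close>

lemma string_zeta_has_sum:
  assumes pos: "\<And>n. n \<in> {1..N} \<Longrightarrow> 0 < r n"
    and less: "(\<Sum>n = 1..N. r n powr Re s) < 1"
  shows "((\<lambda>w. complex_of_real (word_ratio r w) powr s) has_sum string_zeta N r s) (words N)"
proof -
  define f where "f w = complex_of_real (word_ratio r w) powr s" for w
  define q where "q = (\<Sum>n = 1..N. r n powr Re s)"
  have q: "0 \<le> q" "q < 1" using less by (auto simp: q_def sum_nonneg)
  have Cons: "f (n # w) = complex_of_real (r n) powr s * f w"
    if "n \<in> {1..N}" "w \<in> words N" for n w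
    unfolding f_def by (rule word_ratio_powr_Cons[of N]) (use that pos in auto)
  have nCons: "norm (f (n # w)) = r n powr Re s * norm (f w)"
    if "n \<in> {1..N}" "w \<in> words N" for n w
    using Cons[OF that] pos[OF that(1)] by (simp add: norm_mult norm_powr_real_powr)
  have f0: "f [] = 1" by (simp add: f_def word_ratio_def)
  have bound: "(\<Sum>w | w \<in> words N \<and> length w \<le> M. norm (f w)) \<le> 1 / (1 - q)" for M
  proof (induction M)
    case 0
    have "{w. w \<in> words N \<and> length w \<le> 0} = {[]}" by auto
    then show ?case using q by (simp add: f0)
  next
    case (Suc M)
    let ?W = "{w \<in> words N. length w \<le> M}"
    have "(\<Sum>w | w \<in> words N \<and> length w \<le> Suc M. norm (f w)) =
        1 + (\<Sum>w \<in> (\<Union>n\<in>{1..N}. (#) n ` ?W). norm (f w))"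
      unfolding words_Suc
    proof (subst sum.insert)
      show "finite (\<Union>n\<in>{1..N}. (#) n ` ?W)"
        by (intro finite_UN_I finite_imageI finite_words_le) auto
    qed (auto simp: f0)
    also have "(\<Sum>w \<in> (\<Union>n\<in>{1..N}. (#) n ` ?W). norm (f w)) =
        (\<Sum>n\<in>{1..N}. \<Sum>w \<in> (#) n ` ?W. norm (f w))"
    proof (rule sum.UNION_disjoint)
      show "\<forall>n\<in>{1..N}. finite ((#) n ` ?W)"
        by (intro ballI finite_imageI finite_words_le)
    qed auto
    also have "\<dots> = (\<Sum>n\<in>{1..N}. \<Sum>w \<in> ?W. r n powr Re s * norm (f w))"
    proof (rule sum.cong[OF refl])
      fix n assume n: "n \<in> {1..N}"
      have "(\<Sum>w \<in> (#) n ` ?W. norm (f w)) = (\<Sum>w \<in> ?W. norm (f (n # w)))"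
        by (subst sum.reindex) auto
      also have "\<dots> = (\<Sum>w \<in> ?W. r n powr Re s * norm (f w))"
        by (rule sum.cong[OF refl], rule nCons) (use n in auto)
      finally show "(\<Sum>w \<in> (#) n ` ?W. norm (f w)) = (\<Sum>w \<in> ?W. r n powr Re s * norm (f w))" .
    qed
    also have "\<dots> = q * (\<Sum>w \<in> ?W. norm (f w))"
      by (simp add: q_def sum_product)
    also have "1 + \<dots> \<le> 1 + q * (1 / (1 - q))"
      using Suc q by (intro add_left_mono mult_left_mono) auto
    also have "\<dots> = 1 / (1 - q)" using q by (simp add: field_simps)
    finally show ?case .
  qed
  have "(\<lambda>w. norm (f w)) summable_on words N"
  proof (rule nonneg_bdd_above_summable_on)
    show "bdd_above (sum (\<lambda>w. norm (f w)) ` {F. F \<subseteq> words N \<and> finite F})"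
    proof (rule bdd_aboveI2)
      fix F assume "F \<in> {F. F \<subseteq> words N \<and> finite F}"
      then have F: "F \<subseteq> words N" "finite F" by auto
      obtain M where M: "\<And>w. w \<in> F \<Longrightarrow> length w \<le> M"
        using F(2) by (metis finite_imageI finite_nat_set_iff_bounded_le imageI)
      have "sum (\<lambda>w. norm (f w)) F \<le> (\<Sum>w | w \<in> words N \<and> length w \<le> M. norm (f w))"
        by (rule sum_mono2) (use F M finite_words_le[of N M] in auto)
      then show "sum (\<lambda>w. norm (f w)) F \<le> 1 / (1 - q)" using bound[of M] by linarith
    qed
  qed auto
  then have summ: "f summable_on words N"
    by (rule abs_summable_summable)
  then have hs: "(f has_sum infsum f (words N)) (words N)" by simp
  have "(f has_sum complex_of_real (r n) powr s * infsum f (words N)) ((#) n ` words N)"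
    if n: "n \<in> {1..N}" for n
  proof -
    have "((\<lambda>w. complex_of_real (r n) powr s * f w) has_sum
        complex_of_real (r n) powr s * infsum f (words N)) (words N)"
      by (rule has_sum_cmult_right[OF hs])
    then have "((f \<circ> (#) n) has_sum complex_of_real (r n) powr s * infsum f (words N)) (words N)"
      using Cons[OF n] by (subst has_sum_cong[where g = "\<lambda>w. complex_of_real (r n) powr s * f w"]) auto
    then show ?thesis by (subst has_sum_reindex) auto
  qed
  then have "(f has_sum (\<Sum>n\<in>{1..N}. complex_of_real (r n) powr s * infsum f (words N)))
      (\<Union>n\<in>{1..N}. (#) n ` words N)"
    by (intro sum_has_sum) auto
  moreover have "(f has_sum f []) {[]}"
    by (rule has_sum_finiteI) auto
  ultimately have "(f has_sum (f [] + (\<Sum>n\<in>{1..N}. complex_of_real (r n) powr s * infsum f (words N))))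
      ({[]} \<union> (\<Union>n\<in>{1..N}. (#) n ` words N))"
    by (intro has_sum_Un_disjoint) auto
  then have "infsum f (words N) =
      1 + (\<Sum>n\<in>{1..N}. complex_of_real (r n) powr s * infsum f (words N))"
    using infsumI f0 words_unfold[of N] by simp
  then have eq: "infsum f (words N) * (1 - (\<Sum>n\<in>{1..N}. complex_of_real (r n) powr s)) = 1"
    by (simp add: algebra_simps sum_distrib_left)
  then have "1 - (\<Sum>n\<in>{1..N}. complex_of_real (r n) powr s) \<noteq> 0" by auto
  with eq have "infsum f (words N) = string_zeta N r s"
    by (simp add: string_zeta_def field_simps)
  with hs show ?thesis by (simp add: f_def[abs_def])
qed

lemma string_zeta_meromorphic:
  assumes "\<And>n. n \<in> {1..N} \<Longrightarrow> 0 < r n"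
  shows "string_zeta N r meromorphic_on UNIV"
proof -
  have "(\<lambda>s. complex_of_real (r n) powr s) analytic_on UNIV" if "n \<in> {1..N}" for n
    using assms[OF that] by (auto intro!: holomorphic_intros simp: analytic_on_open)
  then have "(\<lambda>s. \<Sum>n = 1..N. complex_of_real (r n) powr s) analytic_on UNIV"
    by (rule analytic_on_sum)
  then show ?thesis
    unfolding string_zeta_def[abs_def]
    by (intro meromorphic_intros analytic_on_imp_meromorphic_on)
qed

definition string_poles :: "nat \<Rightarrow> (nat \<Rightarrow> real) \<Rightarrow> complex set" where
  "string_poles N r = {\<omega>. is_pole (string_zeta N r) \<omega>}"

text \<open>By convention, the (potential) poles of the tubular zeta function of a tiling in
  dimension \<open>d\<close> are the poles of the scaling zeta function together with \<open>0, \<dots>, d\<close>, and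
  ``the poles of the tubular zeta function are simple'' means that the scaling zeta function
  has only simple poles, none of them in \<open>{0, \<dots>, d}\<close>.\<close>

definition tubular_poles :: "nat \<Rightarrow> (nat \<Rightarrow> real) \<Rightarrow> nat \<Rightarrow> complex set" where
  "tubular_poles N r d = string_poles N r \<union> of_nat ` {0..d}"

definition tubular_poles_simple :: "nat \<Rightarrow> (nat \<Rightarrow> real) \<Rightarrow> nat \<Rightarrow> bool" where
  "tubular_poles_simple N r d \<longleftrightarrow>
     (\<forall>\<omega>\<in>string_poles N r. zorder (string_zeta N r) \<omega> = -1) \<and>
     string_poles N r \<inter> of_nat ` {0..d} = {}"


section \<open>Sums over complex dimensions\<close>

definition languid_sequence :: "nat \<Rightarrow> (nat \<Rightarrow> real) \<Rightarrow> (int \<Rightarrow> real) \<Rightarrow> bool" where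
  "languid_sequence N r T \<longleftrightarrow>
     (\<forall>n\<ge>1. T (- n) < 0 \<and> 0 < T n) \<and>
     filterlim (\<lambda>n. T (int n)) at_top sequentially \<and>
     filterlim (\<lambda>n. T (- int n)) at_bot sequentially \<and>
     (\<lambda>n. T (int n) / \<bar>T (- int n)\<bar>) \<longlonglongrightarrow> 1 \<and>
     (\<exists>c>0. \<forall>n \<alpha>. norm (string_zeta N r (Complex \<alpha> (T n))) \<le> c)"

text \<open>The sum of \<open>f\<close> over \<open>A\<close>, as the limit of the partial sums over the horizontal strips
  cut out by \<open>T\<close>.  Finiteness is required because \<open>sum\<close> is \<open>0\<close> on infinite sets.\<close>

definition has_strip_sum ::
    "(int \<Rightarrow> real) \<Rightarrow> (complex \<Rightarrow> complex) \<Rightarrow> complex set \<Rightarrow> complex \<Rightarrow> bool" where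
  "has_strip_sum T f A S \<longleftrightarrow>
     (\<forall>n. finite {\<omega>\<in>A. T (- int n) < Im \<omega> \<and> Im \<omega> < T (int n)}) \<and>
     (\<lambda>n. \<Sum>\<omega> | \<omega> \<in> A \<and> T (- int n) < Im \<omega> \<and> Im \<omega> < T (int n). f \<omega>) \<longlonglongrightarrow> S"

end

theory Submission
  imports Defs "HOL-Real_Asymp.Real_Asymp"
begin

text \<open>Let \<open>V\<close> be the inner parallel volume of the tiling, \<open>h\<close> that of the generator \<open>G\<close>, \<open>\<zeta>\<close> the scaling
  zeta function and \<open>d\<close> the dimension.  The union \<open>W\<close> of all tiles is the disjoint union of \<open>G\<close> and
  the scaled copies \<open>\<Phi> n ` W\<close>, which gives the renewal equation
  \<open>V x = h x + (\<Sum>n = 1..N. r n ^ d * V (x / r n))\<close> (\<open>tiling_volume_unfold\<close>).  By the monophase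
  assumption \<open>h x\<close> is a polynomial \<open>P x\<close> for \<open>x \<le> g\<close> and the constant \<open>P g\<close> for \<open>x \<ge> g\<close>, with
  \<open>\<kappa> d = 0\<close>; its Mellin transform is the explicit rational-exponential function \<open>tube_kernel\<close>, of
  size \<open>1 / s\<^sup>2\<close> on vertical lines.  Formally the Mellin transform of \<open>V\<close> is therefore the kernel
  times \<open>\<zeta>\<close>, and the formula collects the residues of \<open>x powr (d - s) * \<zeta> s * tube_kernel d g \<kappa> s\<close>
  to the left of a line \<open>Re s = \<sigma>\<close>.  Such a line with \<open>d - 1 < \<sigma> < d\<close> and \<open>(\<Sum>n. r n powr \<sigma>) < 1\<close>
  exists since \<open>(\<Sum>n. r n ^ d) < 1\<close>, the generator having positive volume.  The complex dimensions
  contribute \<open>c \<omega> * x powr (d - \<omega>)\<close>, and \<open>k < d\<close> contributes \<open>\<kappa> k * \<zeta> k * x ^ (d - k)\<close>.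

  The limits are taken on the finite segments of the line \<open>Re s = \<sigma>\<close> between the heights \<open>T (- n)\<close>
  and \<open>T n\<close>, with errors \<open>O(1 / R)\<close>, where \<open>R\<close> is the smaller of \<open>T n\<close> and \<open>- T (- n)\<close>.
  Closing a segment by a rectangle of width \<open>R\<close>, to the left for \<open>x \<le> g\<close> and to the right for
  \<open>x \<ge> g\<close>, shows that the truncated inversion integral of the kernel equals \<open>h x\<close> up to
  \<open>O(x powr (d - \<sigma>) / R)\<close>, uniformly in \<open>x > 0\<close> (\<open>tube_integral_small\<close>, \<open>tube_integral_large\<close>).
  The truncated integral \<open>J\<close> with the factor \<open>\<zeta>\<close> satisfies the renewal equation with this
  truncated inversion integral in place of \<open>h\<close>.  So \<open>V - J\<close> satisfies the homogeneous equation up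
  to that error, and as the map on the right-hand side is a contraction for the weight
  \<open>x powr (d - \<sigma>)\<close>, iteration gives \<open>V - J = O(1 / R)\<close> (\<open>renewal_bound\<close>); neither the sum over
  all words nor an improper integral appears.  Finally \<open>J\<close> at a point \<open>x \<le> g\<close> is shifted to the
  left.  Languidity bounds \<open>\<zeta>\<close> on the horizontal sides, and \<open>\<zeta>\<close> is bounded far to the left because
  the terms with the smallest ratio dominate there, so \<open>J\<close> differs by \<open>O(1 / R)\<close> from the sum of
  the residues in the strip (\<open>tube_integral_shift_left\<close>, \<open>renewal_strip_sum\<close>).\<close>

section \<open>Similarities and Lebesgue measure\<close>

lemma similarity_facts:
  fixes f :: "'a::euclidean_space \<Rightarrow> 'a"
  assumes sim: "\<And>x y. dist (f x) (f y) = \<rho> * dist x y" and pos: "0 < \<rho>"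
  shows similarity_image_ball: "f ` ball x e = ball (f x) (\<rho> * e)" and bij_similarity: "bij f"
proof -
  \<comment> \<open>Normalised to an isometry fixing the origin, \<open>f\<close> is an orthogonal map, hence surjective.\<close>
  define h where "h z = (f z - f 0) /\<^sub>R \<rho>" for z
  have "dist (h y) (h z) = dist y z" for y z
  proof -
    have "dist (h y) (h z) = norm ((f y - f z) /\<^sub>R \<rho>)"
      by (simp add: h_def dist_norm flip: scaleR_diff_right)
    also have "\<dots> = dist y z" using sim[of y z] pos by (simp add: dist_norm)
    finally show ?thesis .
  qed
  then have "orthogonal_transformation h"
    by (simp add: orthogonal_transformation_isometry h_def)
  then have "surj h" by (rule orthogonal_transformation_surj)
  have fh: "f z = f 0 + \<rho> *\<^sub>R h z" for z using pos by (simp add: h_def)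
  have surj: "\<exists>z. f z = y" for y
  proof -
    obtain z where "h z = (y - f 0) /\<^sub>R \<rho>" using \<open>surj h\<close> by (metis surjD)
    then show ?thesis using fh[of z] pos by (intro exI[of _ z]) simp
  qed
  show "bij f" unfolding bij_def
  proof
    show "inj f" using sim pos by (metis dist_eq_0_iff injI mult_eq_0_iff order_less_irrefl)
    show "surj f" using surj by (metis surjI)
  qed
  show "f ` ball x e = ball (f x) (\<rho> * e)"
  proof (intro set_eqI iffI)
    fix y assume "y \<in> ball (f x) (\<rho> * e)"
    moreover obtain z where "f z = y" using surj by blast
    ultimately show "y \<in> f ` ball x e" using sim[of x z] pos by auto
  qed (use sim pos in auto)
qed

lemma similarity_image_open:
  fixes f :: "'a::euclidean_space \<Rightarrow> 'a"
  assumes sim: "\<And>x y. dist (f x) (f y) = \<rho> * dist x y" and pos: "0 < \<rho>" and "open S"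
  shows "open (f ` S)"
  unfolding open_contains_ball
proof (intro ballI)
  fix y assume "y \<in> f ` S"
  then obtain x e where "y = f x" "0 < e" "ball x e \<subseteq> S"
    using \<open>open S\<close> by (auto simp: open_contains_ball)
  then have "0 < \<rho> * e" "ball y (\<rho> * e) \<subseteq> f ` S"
    using similarity_image_ball[OF sim pos, of x e] pos by (simp, metis image_mono)
  then show "\<exists>e>0. ball y e \<subseteq> f ` S" by blast
qed

text \<open>By the Vitali covering theorem an open set is, up to a null set, a countable disjoint union of
  balls.  A similarity maps balls to balls and null sets to null sets, so the scaling law for
  the volume of balls is enough.\<close>

lemma emeasure_similarity_image:
  fixes f :: "'a::euclidean_space \<Rightarrow> 'a"
  assumes sim: "\<And>x y. dist (f x) (f y) = \<rho> * dist x y" and pos: "0 < \<rho>" and S: "open S"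
  shows "emeasure lebesgue (f ` S) = ennreal (\<rho> ^ DIM('a)) * emeasure lebesgue S"
proof -
  define K where "K = {(x::'a, e::real). 0 < e \<and> ball x e \<subseteq> S}"
  have cover: "\<exists>i\<in>K. x \<in> ball (fst i) (snd i) \<and> snd i < t" if x: "x \<in> S" and t: "0 < t" for x t
  proof -
    obtain e where "0 < e" "ball x e \<subseteq> S" using S x by (meson open_contains_ball)
    then have "(x, min e (t/2)) \<in> K" using t by (auto simp: K_def)
    then show ?thesis using t \<open>0 < e\<close> by (intro bexI) auto
  qed
  obtain C where C: "countable C" "C \<subseteq> K"
      and disj: "pairwise (\<lambda>i j. disjnt (ball (fst i) (snd i)) (ball (fst j) (snd j))) C"
      and negl: "negligible (S - (\<Union>i \<in> C. ball (fst i) (snd i)))"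
    by (rule Vitali_covering_theorem_balls[of S K fst snd]) (use cover in blast)
  define B where "B i = ball (fst i) (snd i)" for i :: "'a \<times> real"
  have bij: "bij f" and ball: "f ` B i = ball (f (fst i)) (\<rho> * snd i)" for i
    using similarity_facts[OF sim pos] by (auto simp: B_def)
  have "B i \<subseteq> S" if "i \<in> C" for i
    using C(2) that by (cases i) (use subsetD in \<open>fastforce simp: K_def B_def\<close>)
  then have sub: "(\<Union>i\<in>C. B i) \<subseteq> S" by blast
  have dB: "disjoint_family_on B C"
    using disj by (auto simp: disjoint_family_on_def pairwise_def disjnt_def B_def)
  have dfB: "disjoint_family_on (\<lambda>i. f ` B i) C"
    using dB bij by (simp add: disjoint_family_on_def bij_def image_Int[symmetric])
  have "negligible (f ` (S - (\<Union>i\<in>C. B i)))"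
    by (rule negligible_locally_Lipschitz_image)
       (use negl sim in \<open>auto simp: B_def dist_norm intro!: exI[of _ UNIV] exI[of _ \<rho>]\<close>)
  then have negf: "f ` (S - (\<Union>i\<in>C. B i)) \<in> null_sets lebesgue"
    by (simp add: negligible_iff_null_sets)
  have "f ` S = f ` (\<Union>i\<in>C. B i) \<union> f ` (S - (\<Union>i\<in>C. B i))" using sub by blast
  moreover have "(\<Union>i\<in>C. f ` B i) \<in> sets lebesgue"
    using C(1) by (intro sets.countable_UN') (auto simp: ball)
  ultimately have "emeasure lebesgue (f ` S) = emeasure lebesgue (\<Union>i\<in>C. f ` B i)"
    using negf by (simp add: image_UN emeasure_Un_null_set)
  also have "\<dots> = (\<integral>\<^sup>+i. emeasure lebesgue (f ` B i) \<partial>count_space C)"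
    by (rule emeasure_UN_countable) (use C dfB in \<open>auto simp: ball\<close>)
  also have "\<dots> = (\<integral>\<^sup>+i. ennreal (\<rho> ^ DIM('a)) * emeasure lebesgue (B i) \<partial>count_space C)"
  proof (rule nn_integral_cong)
    fix i assume "i \<in> space (count_space C)"
    then have "0 < snd i" using C(2) by (auto simp: K_def)
    then show "emeasure lebesgue (f ` B i) = ennreal (\<rho> ^ DIM('a)) * emeasure lebesgue (B i)"
      unfolding ball using pos
      by (simp add: B_def emeasure_ball power_mult_distrib mult_ac flip: ennreal_mult)
  qed
  also have "\<dots> = ennreal (\<rho> ^ DIM('a)) * (\<integral>\<^sup>+i. emeasure lebesgue (B i) \<partial>count_space C)"
    by (rule nn_integral_cmult) auto
  also have "(\<integral>\<^sup>+i. emeasure lebesgue (B i) \<partial>count_space C) = emeasure lebesgue (\<Union>i\<in>C. B i)"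
    by (rule emeasure_UN_countable[symmetric]) (use C dB in \<open>auto simp: B_def[abs_def]\<close>)
  also have "\<dots> = emeasure lebesgue (\<Union>(B ` C) \<union> (S - (\<Union>i\<in>C. B i)))"
    using negl C(1) by (subst emeasure_Un_null_set)
      (auto simp: B_def negligible_iff_null_sets intro!: sets.countable_UN')
  also have "\<Union>(B ` C) \<union> (S - (\<Union>i\<in>C. B i)) = S" using sub by blast
  finally show ?thesis .
qed

section \<open>Inner parallel sets\<close>

lemma open_infdist_greater: "open {x. e < infdist x A}"
  by (intro open_Collect_less continuous_intros)

text \<open>Of an open set the inner parallel set is a difference of two open sets; this gives its
  measurability, and reduces its volume to volumes of open sets.\<close>

lemma inner_parallel_set_eq: "inner_parallel_set A e = A - A \<inter> {x. e < infdist x (- A)}"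
  by (auto simp: inner_parallel_set_def)

lemma lmeasurable_inner_parallel_set:
  "open A \<Longrightarrow> bounded A \<Longrightarrow> inner_parallel_set A e \<in> lmeasurable"
  unfolding inner_parallel_set_eq
  by (intro fmeasurable_Diff lmeasurable_open sets_completionI_sets)
     (auto intro!: open_Int open_infdist_greater borel_open)

lemma measure_similarity_image:
  fixes f :: "'a::euclidean_space \<Rightarrow> 'a"
  assumes "\<And>x y. dist (f x) (f y) = \<rho> * dist x y" and "0 < \<rho>" and "open S"
  shows "measure lebesgue (f ` S) = \<rho> ^ DIM('a) * measure lebesgue S"
  unfolding measure_def using emeasure_similarity_image[OF assms] assms(2)
  by (simp add: enn2real_mult)

lemma inner_volume_similarity_image:
  fixes f :: "'a::euclidean_space \<Rightarrow> 'a"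
  assumes sim: "\<And>x y. dist (f x) (f y) = \<rho> * dist x y" and pos: "0 < \<rho>"
    and A: "open A" "bounded A"
  shows "inner_volume (f ` A) e = \<rho> ^ DIM('a) * inner_volume A (e / \<rho>)"
proof -
  let ?H = "\<lambda>A e. A \<inter> {x::'a. e < infdist x (- A)}"
  have vol: "inner_volume B t = measure lebesgue B - measure lebesgue (?H B t)"
    if "open B" "bounded B" for B t
  proof -
    have "B \<in> lmeasurable" "?H B t \<in> lmeasurable"
      using that by (auto intro!: lmeasurable_open open_Int open_infdist_greater)
    then show ?thesis unfolding inner_volume_def inner_parallel_set_eq
      by (intro measurable_measure_Diff) auto
  qed
  have bij: "bij f" by (rule bij_similarity[OF sim pos])
  have of: "open (f ` A)" by (rule similarity_image_open[OF sim pos A(1)])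
  obtain x0 b where "A \<subseteq> ball x0 b" using A(2) bounded_subset_ballD by blast
  then have "f ` A \<subseteq> ball (f x0) (\<rho> * b)" using similarity_image_ball[OF sim pos] by blast
  then have bf: "bounded (f ` A)" using bounded_ball bounded_subset by blast
  have "infdist (f x) (- (f ` A)) = \<rho> * infdist x (- A)" for x
  proof (cases "A = UNIV")
    case True
    then show ?thesis using bij by (simp add: bij_def infdist_def)
  next
    case False
    have ne: "- A \<noteq> {}" using False by blast
    have eq: "- (f ` A) = f ` (- A)" using bij by (simp add: bij_image_Compl_eq)
    have "infdist (f x) (f ` (- A)) = (INF a\<in>-A. \<rho> * dist x a)"
      using ne by (simp add: infdist_notempty image_image sim)
    also have "\<dots> = \<rho> * (INF a\<in>-A. dist x a)"
    proof (rule antisym)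
      show "(INF a\<in>-A. \<rho> * dist x a) \<le> \<rho> * (INF a\<in>-A. dist x a)"
      proof -
        have "(INF a\<in>-A. \<rho> * dist x a) / \<rho> \<le> (INF a\<in>-A. dist x a)"
        proof (rule cINF_greatest[OF ne])
          fix a assume "a \<in> - A"
          then have "(INF a\<in>-A. \<rho> * dist x a) \<le> \<rho> * dist x a"
            using pos by (intro cINF_lower bdd_belowI2[of _ 0]) auto
          then show "(INF a\<in>-A. \<rho> * dist x a) / \<rho> \<le> dist x a" using pos by (simp add: field_simps)
        qed
        then show ?thesis using pos by (simp add: field_simps)
      qed
      show "\<rho> * (INF a\<in>-A. dist x a) \<le> (INF a\<in>-A. \<rho> * dist x a)"
        using pos by (intro cINF_greatest[OF ne] mult_left_mono cINF_lower bdd_belowI2[of _ 0]) auto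
    qed
    finally show ?thesis using ne eq by (simp add: infdist_notempty)
  qed
  then have "?H (f ` A) e = f ` ?H A (e / \<rho>)" using pos bij
    by (auto simp: field_simps bij_def dest: injD)
  moreover have "open (?H A (e / \<rho>))" using A by (intro open_Int open_infdist_greater)
  ultimately have "measure lebesgue (?H (f ` A) e) = \<rho> ^ DIM('a) * measure lebesgue (?H A (e / \<rho>))"
    using measure_similarity_image[OF sim pos] by metis
  moreover have "measure lebesgue (f ` A) = \<rho> ^ DIM('a) * measure lebesgue A"
    by (rule measure_similarity_image[OF sim pos A(1)])
  ultimately show ?thesis
    unfolding vol[OF of bf, of e] vol[OF A, of "e / \<rho>"] by (simp only: right_diff_distrib)
qed

text \<open>A ball around a point of a member \<open>A\<close> that stays inside the union stays inside \<open>A\<close>, because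
  a connected set is not split by disjoint open sets.  So the distance to the complement of the
  union is the distance to the complement of \<open>A\<close>.\<close>

lemma inner_parallel_set_Union:
  fixes \<A> :: "'a::euclidean_space set set"
  assumes op: "\<And>A. A \<in> \<A> \<Longrightarrow> open A" and disj: "disjoint \<A>" and bdd: "bounded (\<Union>\<A>)"
  shows "inner_parallel_set (\<Union>\<A>) e = (\<Union>A\<in>\<A>. inner_parallel_set A e)"
proof -
  have "infdist x (- \<Union>\<A>) = infdist x (- A)" if A: "A \<in> \<A>" "x \<in> A" for x A
  proof (rule antisym)
    have ne: "- \<Union>\<A> \<noteq> {}" using bdd not_bounded_UNIV by (metis Compl_empty_eq double_compl)
    then show "infdist x (- A) \<le> infdist x (- \<Union>\<A>)" using A by (intro infdist_mono) auto
    define t where "t = infdist x (- \<Union>\<A>)"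
    have "ball x t \<subseteq> A"
    proof (cases "t > 0")
      case True
      have sub: "ball x t \<subseteq> \<Union>\<A>"
        using infdist_le[of _ "- \<Union>\<A>" x] by (force simp: t_def)
      have "A \<inter> ball x t = {} \<or> \<Union>(\<A> - {A}) \<inter> ball x t = {}"
      proof (rule connectedD[OF connected_ball])
        show "A \<inter> \<Union>(\<A> - {A}) \<inter> ball x t = {}" using disj A(1) by (auto simp: disjoint_def)
      qed (use op A sub in auto)
      then show ?thesis using A True sub by auto
    qed (simp add: ball_empty)
    moreover have "- A \<noteq> {}" using ne A by blast
    ultimately show "infdist x (- \<Union>\<A>) \<le> infdist x (- A)" unfolding t_def[symmetric] infdist_notempty[OF \<open>- A \<noteq> {}\<close>]
      by (intro cINF_greatest) (auto simp: subset_iff not_less[symmetric])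
  qed
  then show ?thesis by (auto simp: inner_parallel_set_def)
qed

lemma inner_volume_ge_inradius:
  fixes G :: "'a::euclidean_space set"
  assumes "open G" "bounded G" "inradius G \<le> e"
  shows "inner_volume G e = measure lebesgue G"
proof -
  have "infdist x (- G) \<le> e" if "x \<in> G" for x
  proof -
    obtain b where b: "G \<subseteq> ball x b" using bounded_subset_ballD[OF assms(2), of x] by blast
    have bdd: "bdd_above {\<rho>. \<exists>x. ball x \<rho> \<subseteq> G}"
    proof (rule bdd_aboveI)
      fix \<rho> assume "\<rho> \<in> {\<rho>. \<exists>x. ball x \<rho> \<subseteq> G}"
      then obtain y where "ball y \<rho> \<subseteq> ball x b" using b by blast
      then show "\<rho> \<le> \<bar>b\<bar>" by (auto simp: ball_subset_ball_iff) (metis abs_ge_self add_increasing order.trans zero_le_dist add.commute le_add_same_cancel2)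
    qed
    have "ball x (infdist x (- G)) \<subseteq> G" using infdist_le[of _ "- G" x] by force
    then have "infdist x (- G) \<le> inradius G"
      unfolding inradius_def by (intro cSup_upper bdd) auto
    then show ?thesis using assms(3) by simp
  qed
  then have "inner_parallel_set G e = G" by (auto simp: inner_parallel_set_def)
  then show ?thesis by (simp add: inner_volume_def)
qed

lemma inner_volume_tendsto_0:
  fixes G :: "'a::euclidean_space set"
  assumes "open G" "bounded G"
  shows "(\<lambda>n. inner_volume G (1 / real (Suc n))) \<longlonglongrightarrow> 0"
proof -
  let ?A = "\<lambda>n. inner_parallel_set G (1 / real (Suc n))"
  have ne: "- G \<noteq> {}" using assms(2) not_bounded_UNIV by (metis Compl_empty_eq double_compl)
  have "(\<lambda>n. measure lebesgue (?A n)) \<longlonglongrightarrow> measure lebesgue (\<Inter>n. ?A n)"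
  proof (rule Lim_measure_decseq)
    show "range ?A \<subseteq> sets lebesgue" "\<And>n. emeasure lebesgue (?A n) \<noteq> \<infinity>"
      using fmeasurableD[OF lmeasurable_inner_parallel_set[OF assms]]
        fmeasurableD2[OF lmeasurable_inner_parallel_set[OF assms]] by auto
    show "decseq ?A"
      by (auto simp: decseq_def inner_parallel_set_def frac_le elim!: order_trans)
  qed
  moreover have "(\<Inter>n. ?A n) = {}"
  proof -
    have "\<exists>n. x \<notin> ?A n" if "x \<in> G" for x
    proof -
      have "0 < infdist x (- G)"
        using that ne assms(1) by (intro infdist_pos_not_in_closed) auto
      then obtain n where "1 / real (Suc n) < infdist x (- G)"
        using nat_approx_posE by blast
      then show ?thesis by (auto simp: inner_parallel_set_def not_le)
    qed
    then show ?thesis by (auto simp: inner_parallel_set_def)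
  qed
  ultimately show ?thesis by (simp add: inner_volume_def)
qed

text \<open>The polynomial tends to \<open>\<kappa> d\<close> as its argument tends to \<open>0\<close>, while the inner parallel sets of an
  open set shrink to the empty set.\<close>

lemma monophase_top_coefficient:
  fixes G :: "'a::euclidean_space set"
  assumes "open G" "bounded G" "0 < inradius G" "monophase_with G \<kappa>"
  shows "\<kappa> DIM('a) = 0"
proof -
  let ?d = "DIM('a)"
  have lim: "(\<lambda>n. 1 / real (Suc n)) \<longlonglongrightarrow> 0" by (rule LIMSEQ_Suc[OF lim_1_over_n])
  have "(\<lambda>n. \<Sum>k = 0..?d. \<kappa> k * (1 / real (Suc n)) ^ (?d - k)) \<longlonglongrightarrow> (\<Sum>k = 0..?d. \<kappa> k * 0 ^ (?d - k))"
    by (intro tendsto_sum tendsto_mult tendsto_const tendsto_power lim)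
  also have "(\<Sum>k = 0..?d. \<kappa> k * 0 ^ (?d - k)) = \<kappa> ?d"
  proof -
    have "(\<Sum>k = 0..?d. \<kappa> k * 0 ^ (?d - k)) = (\<Sum>k = 0..?d. if k = ?d then \<kappa> k else 0)"
      by (rule sum.cong) (auto simp: power_0_left)
    then show ?thesis by simp
  qed
  finally have "(\<lambda>n. \<Sum>k = 0..?d. \<kappa> k * (1 / real (Suc n)) ^ (?d - k)) \<longlonglongrightarrow> \<kappa> ?d" .
  moreover have "eventually (\<lambda>n. (\<Sum>k = 0..?d. \<kappa> k * (1 / real (Suc n)) ^ (?d - k))
      = inner_volume G (1 / real (Suc n))) sequentially"
    using order_tendstoD(2)[OF lim assms(3)]
    by eventually_elim (use assms(4) in \<open>simp add: monophase_with_def\<close>)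
  ultimately have "(\<lambda>n. inner_volume G (1 / real (Suc n))) \<longlonglongrightarrow> \<kappa> ?d"
    by (rule Lim_transform_eventually)
  then show ?thesis
    using inner_volume_tendsto_0[OF assms(1,2)] by (rule LIMSEQ_unique)
qed

section \<open>The functional equation of the tiling volume\<close>

lemma self_similar_tiling_facts:
  fixes \<Phi> :: "nat \<Rightarrow> 'a::euclidean_space \<Rightarrow> 'a"
  assumes sim: "contractive_similarities N \<Phi> r" and feas: "feasible_open_set N \<Phi> U"
    and gen: "generators N \<Phi> U = {G}"
  defines "W \<equiv> \<Union>(self_similar_tiling N \<Phi> U)"
  shows generator_eq: "G = U - ifs_image N \<Phi> (closure U)"
    and open_generator: "open G" and generator_nonempty: "G \<noteq> {}"
    and tiling_subset: "W \<subseteq> U" and open_tiling: "open W"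
    and tiling_unfold: "W = G \<union> (\<Union>n\<in>{1..N}. \<Phi> n ` W)"
proof -
  have dist: "dist (\<Phi> n x) (\<Phi> n y) = r n * dist x y" and pos: "0 < r n" if "n \<in> {1..N}" for n x y
    using sim that by (auto simp: contractive_similarities_def)
  have "\<Union>(generators N \<Phi> U) = U - ifs_image N \<Phi> (closure U)"
    unfolding generators_def by simp
  then show G: "G = U - ifs_image N \<Phi> (closure U)" by (simp add: gen)
  have "compact (\<Phi> n ` closure U)" if "n \<in> {1..N}" for n
  proof (rule compact_continuous_image)
    show "continuous_on (closure U) (\<Phi> n)"
      by (rule lipschitz_on_continuous_on[of "r n"], rule lipschitz_onI)
         (use dist[OF that] pos[OF that] in auto)
    show "compact (closure U)" using feas by (simp add: feasible_open_set_def compact_closure)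
  qed
  then have "closed (ifs_image N \<Phi> (closure U))"
    unfolding ifs_image_def by (intro compact_imp_closed compact_UN) auto
  then show oG: "open G" unfolding G using feas by (simp add: feasible_open_set_def open_Diff)
  have "G \<in> components (U - ifs_image N \<Phi> (closure U))" using gen by (simp add: generators_def)
  then show "G \<noteq> {}" by (rule in_components_nonempty)
  have W: "W = (\<Union>w\<in>words N. word_map \<Phi> w ` G)"
    by (auto simp: W_def self_similar_tiling_def gen)
  have sub: "word_map \<Phi> w ` U \<subseteq> U" if "w \<in> words N" for w
    using that
  proof (induction rule: lists.induct)
    case (Cons n w)
    then have "\<Phi> n ` word_map \<Phi> w ` U \<subseteq> \<Phi> n ` U" by (intro image_mono)
    moreover have "\<Phi> n ` U \<subseteq> U" using feas Cons by (simp add: feasible_open_set_def)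
    ultimately have "\<Phi> n ` word_map \<Phi> w ` U \<subseteq> U" by (rule order_trans)
    then show ?case by (simp add: image_comp)
  qed auto
  moreover have "G \<subseteq> U" unfolding G by blast
  ultimately show "W \<subseteq> U" unfolding W by (intro UN_least) (meson image_mono order_trans)
  have "open (word_map \<Phi> w ` G)" if "w \<in> words N" for w
    using that
  proof (induction rule: lists.induct)
    case (Cons n w)
    then show ?case using similarity_image_open[OF dist pos, of n "word_map \<Phi> w ` G"]
      by (simp add: image_comp)
  qed (use oG in auto)
  then show "open W" unfolding W by (intro open_UN) simp
  have "W = (\<Union>w\<in>insert [] (\<Union>n\<in>{1..N}. (#) n ` words N). word_map \<Phi> w ` G)"
    unfolding W words_unfold[symmetric] ..
  also have "\<dots> = G \<union> (\<Union>n\<in>{1..N}. \<Union>w\<in>words N. \<Phi> n ` word_map \<Phi> w ` G)"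
    by (simp add: image_comp)
  also have "\<dots> = G \<union> (\<Union>n\<in>{1..N}. \<Phi> n ` W)"
    unfolding W by (simp only: image_UN)
  finally show "W = G \<union> (\<Union>n\<in>{1..N}. \<Phi> n ` W)" .
qed

lemma measure_Un_UN_disjoint:
  assumes "finite I" "A \<in> fmeasurable M" "\<And>i. i \<in> I \<Longrightarrow> F i \<in> fmeasurable M"
    and "\<And>i. i \<in> I \<Longrightarrow> A \<inter> F i = {}"
    and "\<And>i j. i \<in> I \<Longrightarrow> j \<in> I \<Longrightarrow> i \<noteq> j \<Longrightarrow> F i \<inter> F j = {}"
  shows "measure M (A \<union> (\<Union>i\<in>I. F i)) = measure M A + (\<Sum>i\<in>I. measure M (F i))"
proof -
  have "measure M (A \<union> (\<Union>i\<in>I. F i)) = measure M A + measure M (\<Union>i\<in>I. F i)"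
    using assms by (intro measure_Un_AE fmeasurable.finite_UN always_eventually) auto
  also have "measure M (\<Union>i\<in>I. F i) = (\<Sum>i\<in>I. measure M (F i))"
    using assms by (intro measure_UNION') (auto simp: pairwise_def disjnt_def)
  finally show ?thesis .
qed

text \<open>The union \<open>W\<close> of the tiles is the disjoint union of the open sets \<open>G\<close>, \<open>\<Phi> 1 ` W\<close>, \<dots>,
  \<open>\<Phi> N ` W\<close>, and each of the latter is a scaled copy of \<open>W\<close>.\<close>

lemma tiling_volume_unfold:
  fixes \<Phi> :: "nat \<Rightarrow> 'a::euclidean_space \<Rightarrow> 'a"
  assumes sim: "contractive_similarities N \<Phi> r" and feas: "feasible_open_set N \<Phi> U"
    and gen: "generators N \<Phi> U = {G}"
  shows "tiling_volume (self_similar_tiling N \<Phi> U) e = inner_volume G e +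
           (\<Sum>n = 1..N. r n ^ DIM('a) * tiling_volume (self_similar_tiling N \<Phi> U) (e / r n))"
proof -
  define W where "W = \<Union>(self_similar_tiling N \<Phi> U)"
  note facts = self_similar_tiling_facts[OF sim feas gen, folded W_def]
  have dist: "dist (\<Phi> n x) (\<Phi> n y) = r n * dist x y" and pos: "0 < r n" if "n \<in> {1..N}" for n x y
    using sim that by (auto simp: contractive_similarities_def)
  have bU: "bounded U" using feas by (simp add: feasible_open_set_def)
  have bW: "bounded W" using bU facts(4) bounded_subset by blast
  have bG: "bounded G" using bU facts(1) by (metis bounded_diff)
  have oW: "open (\<Phi> n ` W)" if "n \<in> {1..N}" for n
    using similarity_image_open[OF dist[OF that] pos[OF that] facts(5)] .
  have disjW: "\<Phi> n ` W \<inter> \<Phi> m ` W = {}" if "n \<in> {1..N}" "m \<in> {1..N}" "n \<noteq> m" for n m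
    using feas that facts(4) unfolding feasible_open_set_def by (metis (no_types, opaque_lifting) Int_mono image_mono subset_empty)
  have disjG: "G \<inter> \<Phi> n ` W = {}" if "n \<in> {1..N}" for n
  proof -
    have "\<Phi> n ` W \<subseteq> ifs_image N \<Phi> (closure U)"
      using facts(4) closure_subset[of U] that unfolding ifs_image_def by blast
    then show ?thesis by (subst facts(1)) blast
  qed
  have bWn: "bounded (\<Phi> n ` W)" if "n \<in> {1..N}" for n
    using facts(6) bW that by (metis UN_upper Un_upper2 bounded_subset order_trans)
  let ?\<A> = "insert G ((\<lambda>n. \<Phi> n ` W) ` {1..N})"
  have W: "W = \<Union>?\<A>" using facts(6) by auto
  have "disjoint ?\<A>" unfolding disjoint_def
  proof (intro ballI impI)
    fix A B assume "A \<in> ?\<A>" "B \<in> ?\<A>" "A \<noteq> B"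
    then consider n where "n \<in> {1..N}" "A = G" "B = \<Phi> n ` W" | n where "n \<in> {1..N}" "B = G" "A = \<Phi> n ` W"
      | n m where "n \<in> {1..N}" "m \<in> {1..N}" "A = \<Phi> n ` W" "B = \<Phi> m ` W" "n \<noteq> m"
      by blast
    then show "A \<inter> B = {}"
    proof cases
      case (1 n)
      then show ?thesis using disjG[of n] by simp
    next
      case (2 n)
      then show ?thesis using disjG[of n] by (simp add: Int_commute)
    next
      case (3 n m)
      then show ?thesis using disjW[of n m] by simp
    qed
  qed
  then have "inner_parallel_set W e = (\<Union>A\<in>?\<A>. inner_parallel_set A e)"
    using W bW oW facts(2) by (subst W, intro inner_parallel_set_Union) auto
  also have "\<dots> = inner_parallel_set G e \<union> (\<Union>n\<in>{1..N}. inner_parallel_set (\<Phi> n ` W) e)"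
    by auto
  finally have eq: "inner_parallel_set W e =
    inner_parallel_set G e \<union> (\<Union>n\<in>{1..N}. inner_parallel_set (\<Phi> n ` W) e)" .
  have sub: "inner_parallel_set A e \<subseteq> A" for A :: "'a set" by (auto simp: inner_parallel_set_def)
  have "inner_volume W e = inner_volume G e + (\<Sum>n = 1..N. inner_volume (\<Phi> n ` W) e)"
    unfolding inner_volume_def eq
  proof (rule measure_Un_UN_disjoint)
    show "inner_parallel_set G e \<inter> inner_parallel_set (\<Phi> n ` W) e = {}" if "n \<in> {1..N}" for n
      using Int_mono[OF sub[of G] sub[of "\<Phi> n ` W"]] disjG[OF that] by simp
    show "inner_parallel_set (\<Phi> n ` W) e \<inter> inner_parallel_set (\<Phi> m ` W) e = {}"
      if "n \<in> {1..N}" "m \<in> {1..N}" "n \<noteq> m" for n m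
      using Int_mono[OF sub[of "\<Phi> n ` W"] sub[of "\<Phi> m ` W"]] disjW[OF that] by simp
    show "inner_parallel_set (\<Phi> n ` W) e \<in> lmeasurable" if "n \<in> {1..N}" for n
      by (rule lmeasurable_inner_parallel_set[OF oW[OF that] bWn[OF that]])
  qed (simp_all add: lmeasurable_inner_parallel_set[OF facts(2) bG])
  also have "(\<Sum>n = 1..N. inner_volume (\<Phi> n ` W) e) =
      (\<Sum>n = 1..N. r n ^ DIM('a) * inner_volume W (e / r n))"
    by (intro sum.cong refl inner_volume_similarity_image dist pos facts(5) bW)
  finally show ?thesis by (simp add: tiling_volume_def W_def)
qed

lemma tiling_volume_bounds:
  fixes \<Phi> :: "nat \<Rightarrow> 'a::euclidean_space \<Rightarrow> 'a"
  assumes sim: "contractive_similarities N \<Phi> r" and feas: "feasible_open_set N \<Phi> U"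
    and gen: "generators N \<Phi> U = {G}"
  shows "\<bar>tiling_volume (self_similar_tiling N \<Phi> U) e\<bar> \<le> measure lebesgue U"
proof -
  define W where "W = \<Union>(self_similar_tiling N \<Phi> U)"
  note facts = self_similar_tiling_facts[OF sim feas gen, folded W_def]
  have U: "open U" "bounded U" using feas by (simp_all add: feasible_open_set_def)
  have "inner_parallel_set W e \<in> lmeasurable"
    using facts(4,5) U(2) bounded_subset by (intro lmeasurable_inner_parallel_set) auto
  then have "inner_volume W e \<le> measure lebesgue U"
    unfolding inner_volume_def using facts(4) U
    by (intro measure_mono_fmeasurable lmeasurable_open) (auto simp: inner_parallel_set_def fmeasurableD)
  then show ?thesis by (simp add: tiling_volume_def inner_volume_def W_def)
qed

text \<open>The disjoint sets \<open>\<Phi> n ` U\<close> and the generator, which has positive volume, all lie in \<open>U\<close>.\<close>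

lemma sum_ratio_power_less_1:
  fixes \<Phi> :: "nat \<Rightarrow> 'a::euclidean_space \<Rightarrow> 'a"
  assumes sim: "contractive_similarities N \<Phi> r" and feas: "feasible_open_set N \<Phi> U"
    and gen: "generators N \<Phi> U = {G}"
  shows "(\<Sum>n = 1..N. r n ^ DIM('a)) < 1"
proof -
  note facts = self_similar_tiling_facts[OF sim feas gen]
  have dist: "dist (\<Phi> n x) (\<Phi> n y) = r n * dist x y" and pos: "0 < r n" if "n \<in> {1..N}" for n x y
    using sim that by (auto simp: contractive_similarities_def)
  have U: "open U" "bounded U" "U \<noteq> {}" using feas by (simp_all add: feasible_open_set_def)
  have UnU: "\<Phi> n ` U \<subseteq> U" if "n \<in> {1..N}" for n
    using feas that by (simp add: feasible_open_set_def)
  have meas: "A \<in> lmeasurable" if "open A" "A \<subseteq> U" for A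
    using that U(2) bounded_subset by (auto intro!: lmeasurable_open)
  have mn: "\<Phi> n ` U \<in> lmeasurable" if "n \<in> {1..N}" for n
    using that by (intro meas similarity_image_open[OF dist pos U(1)] UnU) auto
  have mG: "G \<in> lmeasurable" using facts(1,2) by (intro meas) auto
  have "measure lebesgue G + (\<Sum>n = 1..N. r n ^ DIM('a)) * measure lebesgue U =
      measure lebesgue G + (\<Sum>n = 1..N. measure lebesgue (\<Phi> n ` U))"
    using measure_similarity_image[OF dist pos U(1)] by (simp add: sum_distrib_right)
  also have "\<dots> = measure lebesgue (G \<union> (\<Union>n\<in>{1..N}. \<Phi> n ` U))"
  proof (rule measure_Un_UN_disjoint[symmetric])
    show "G \<inter> \<Phi> n ` U = {}" if "n \<in> {1..N}" for n
    proof -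
      have "\<Phi> n ` U \<subseteq> ifs_image N \<Phi> (closure U)"
        using closure_subset[of U] that unfolding ifs_image_def by blast
      then show ?thesis by (subst facts(1)) blast
    qed
    show "\<Phi> n ` U \<inter> \<Phi> m ` U = {}" if "n \<in> {1..N}" "m \<in> {1..N}" "n \<noteq> m" for n m
      using feas that unfolding feasible_open_set_def by metis
  qed (simp_all add: mG mn)
  also have "\<dots> \<le> measure lebesgue U"
  proof (rule measure_mono_fmeasurable)
    show "G \<union> (\<Union>n\<in>{1..N}. \<Phi> n ` U) \<subseteq> U"
      using UnU by (subst facts(1)) blast
    show "G \<union> (\<Union>n\<in>{1..N}. \<Phi> n ` U) \<in> sets lebesgue"
      using mG mn by (intro sets.Un sets.finite_UN fmeasurableD) auto
    show "U \<in> lmeasurable" using U(1) by (rule meas) simp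
  qed
  moreover have "0 < measure lebesgue G"
    using open_not_negligible[OF facts(2,3)] mG by (simp add: negligible_iff_measure0 zero_less_measure_iff)
  ultimately have "(\<Sum>n = 1..N. r n ^ DIM('a)) * measure lebesgue U < 1 * measure lebesgue U"
    by linarith
  then show ?thesis by (meson measure_nonneg mult_less_cancel_right_disj not_less)
qed

section \<open>Integrals over vertical segments and residues\<close>

abbreviation vertical_path :: "real \<Rightarrow> real \<Rightarrow> real \<Rightarrow> real \<Rightarrow> complex" where
  "vertical_path x y0 y1 \<equiv> linepath (Complex x y0) (Complex x y1)"

lemma vertical_path_image: "y0 \<le> y1 \<Longrightarrow>
    closed_segment (Complex x y0) (Complex x y1) = {z. Re z = x \<and> y0 \<le> Im z \<and> Im z \<le> y1}"
  by (auto simp: closed_segment_same_Re closed_segment_eq_real_ivl)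

lemma horizontal_path_image: "x0 \<le> x1 \<Longrightarrow>
    closed_segment (Complex x0 y) (Complex x1 y) = {z. Im z = y \<and> x0 \<le> Re z \<and> Re z \<le> x1}"
  by (auto simp: closed_segment_same_Im closed_segment_eq_real_ivl)

text \<open>The residue theorem on a rectangle, with the two horizontal sides estimated by the maximum of
  the integrand.\<close>

lemma vertical_integral_difference:
  assumes xy: "x0 < x1" "y0 < y1" and S: "open S" "connected S"
    and sub: "cbox (Complex x0 y0) (Complex x1 y1) \<subseteq> S"
    and pts: "finite pts" and holo: "F holomorphic_on S - pts"
    and inside: "pts \<inter> cbox (Complex x0 y0) (Complex x1 y1) \<subseteq> box (Complex x0 y0) (Complex x1 y1)"
    and B: "\<And>z. x0 \<le> Re z \<Longrightarrow> Re z \<le> x1 \<Longrightarrow> Im z = y0 \<or> Im z = y1 \<Longrightarrow> norm (F z) \<le> B"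
  shows "norm (contour_integral (vertical_path x1 y0 y1) F - contour_integral (vertical_path x0 y0 y1) F
            - 2 * pi * \<i> * (\<Sum>p\<in>pts \<inter> box (Complex x0 y0) (Complex x1 y1). residue F p)) \<le> 2 * B * (x1 - x0)"
proof -
  define a1 a2 a3 a4 where "a1 = Complex x0 y0" and "a2 = Complex x1 y0"
    and "a3 = Complex x1 y1" and "a4 = Complex x0 y1"
  have rect: "rectpath a1 a3 = linepath a1 a2 +++ linepath a2 a3 +++ linepath a3 a4 +++ linepath a4 a1"
    by (simp add: rectpath_def Let_def a1_def a2_def a3_def a4_def)
  have img: "path_image (rectpath a1 a3) = cbox a1 a3 - box a1 a3"
    using xy by (intro path_image_rectpath_cbox_minus_box) (auto simp: a1_def a3_def)
  then have img_sub: "path_image (rectpath a1 a3) \<subseteq> S - pts"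
    using sub inside by (auto simp: a1_def a3_def)
  then have segs: "closed_segment a1 a2 \<subseteq> S - pts" "closed_segment a2 a3 \<subseteq> S - pts"
    "closed_segment a3 a4 \<subseteq> S - pts" "closed_segment a4 a1 \<subseteq> S - pts"
    unfolding rect by (auto simp: path_image_join)
  have cont: "continuous_on (S - pts) F" by (rule holomorphic_on_imp_continuous_on[OF holo])
  have int: "F contour_integrable_on linepath a1 a2" "F contour_integrable_on linepath a2 a3"
    "F contour_integrable_on linepath a3 a4" "F contour_integrable_on linepath a4 a1"
    by (intro contour_integrable_continuous_linepath continuous_on_subset[OF cont] segs)+
  have "contour_integral (rectpath a1 a3) F =
      2 * pi * \<i> * (\<Sum>p\<in>pts. winding_number (rectpath a1 a3) p * residue F p)"
  proof (rule Residue_theorem[OF S pts holo])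
    show "path_image (rectpath a1 a3) \<subseteq> S - pts" by (rule img_sub)
    show "\<forall>z. z \<notin> S \<longrightarrow> winding_number (rectpath a1 a3) z = 0"
      using sub xy by (auto simp: a1_def a3_def intro!: winding_number_rectpath_outside)
  qed auto
  also have "(\<Sum>p\<in>pts. winding_number (rectpath a1 a3) p * residue F p) =
      (\<Sum>p\<in>pts. if p \<in> box a1 a3 then residue F p else 0)"
  proof (rule sum.cong[OF refl])
    fix p assume p: "p \<in> pts"
    show "winding_number (rectpath a1 a3) p * residue F p = (if p \<in> box a1 a3 then residue F p else 0)"
    proof (cases "p \<in> box a1 a3")
      case False
      then have "p \<notin> cbox a1 a3" using inside p by (auto simp: a1_def a3_def)
      then have "winding_number (rectpath a1 a3) p = 0"
        using xy by (intro winding_number_rectpath_outside) (auto simp: a1_def a3_def)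
      then show ?thesis using False by simp
    qed (simp add: winding_number_rectpath)
  qed
  also have "\<dots> = (\<Sum>p\<in>pts \<inter> box a1 a3. residue F p)"
    by (rule sum.inter_restrict[OF pts, symmetric])
  finally have "contour_integral (linepath a1 a2) F + (contour_integral (linepath a2 a3) F
      + (contour_integral (linepath a3 a4) F + contour_integral (linepath a4 a1) F))
      = 2 * pi * \<i> * (\<Sum>p\<in>pts \<inter> box a1 a3. residue F p)"
    unfolding rect using int by simp
  moreover have "contour_integral (linepath a4 a1) F = - contour_integral (linepath a1 a4) F"
    using continuous_on_subset[OF cont segs(4)] by (simp add: contour_integral_reverse_linepath)
  ultimately have eq: "contour_integral (linepath a2 a3) F - contour_integral (linepath a1 a4) F
      - 2 * pi * \<i> * (\<Sum>p\<in>pts \<inter> box a1 a3. residue F p)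
      = - contour_integral (linepath a1 a2) F - contour_integral (linepath a3 a4) F"
    by (simp add: algebra_simps)
  have B0: "0 \<le> B" using B[of a1] xy by (auto simp: a1_def intro: order_trans[OF norm_ge_zero])
  have "norm (contour_integral (linepath a1 a2) F) \<le> B * norm (a2 - a1)"
  proof (rule contour_integral_bound_linepath[OF int(1) B0])
    fix z assume "z \<in> closed_segment a1 a2"
    then show "norm (F z) \<le> B" using xy by (auto simp: a1_def a2_def horizontal_path_image intro!: B)
  qed
  moreover have "norm (contour_integral (linepath a3 a4) F) \<le> B * norm (a4 - a3)"
  proof (rule contour_integral_bound_linepath[OF int(3) B0])
    fix z assume "z \<in> closed_segment a3 a4"
    then have "z \<in> closed_segment a4 a3" by (simp add: closed_segment_commute)
    then show "norm (F z) \<le> B" using xy by (auto simp: a3_def a4_def horizontal_path_image intro!: B)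
  qed
  moreover have "norm (a2 - a1) = x1 - x0" "norm (a4 - a3) = x1 - x0"
    using xy by (auto simp: a1_def a2_def a3_def a4_def cmod_def)
  ultimately have "norm (- contour_integral (linepath a1 a2) F - contour_integral (linepath a3 a4) F)
      \<le> 2 * B * (x1 - x0)"
    using norm_triangle_ineq4[of "- contour_integral (linepath a1 a2) F" "contour_integral (linepath a3 a4) F"]
    by simp
  then show ?thesis
    unfolding eq[symmetric] by (simp add: a1_def a2_def a3_def a4_def)
qed

lemma vertical_integral_bound:
  assumes "y0 < y1" "continuous_on {z. Re z = x \<and> y0 \<le> Im z \<and> Im z \<le> y1} F"
    and B: "\<And>z. Re z = x \<Longrightarrow> y0 \<le> Im z \<Longrightarrow> Im z \<le> y1 \<Longrightarrow> norm (F z) \<le> B"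
  shows "norm (contour_integral (vertical_path x y0 y1) F) \<le> B * (y1 - y0)"
proof -
  have B0: "0 \<le> B" using B[of "Complex x y0"] assms(1) by (auto intro: order_trans[OF norm_ge_zero])
  have "norm (contour_integral (vertical_path x y0 y1) F) \<le> B * norm (Complex x y1 - Complex x y0)"
    using assms(1,2) B
    by (intro contour_integral_bound_linepath[OF _ B0] contour_integrable_continuous_linepath)
       (auto simp: vertical_path_image)
  then show ?thesis using assms(1) by (simp add: cmod_def)
qed

lemma vertical_integral_residues:
  assumes xy: "x0 < x1" "y0 < y1" and S: "open S" "connected S"
    and sub: "cbox (Complex x0 y0) (Complex x1 y1) \<subseteq> S"
    and pts: "finite pts" and holo: "F holomorphic_on S - pts"
    and inside: "pts \<inter> cbox (Complex x0 y0) (Complex x1 y1) \<subseteq> box (Complex x0 y0) (Complex x1 y1)"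
    and B: "\<And>z. x0 \<le> Re z \<Longrightarrow> Re z \<le> x1 \<Longrightarrow> Im z = y0 \<or> Im z = y1 \<Longrightarrow> norm (F z) \<le> B"
  defines "\<Sigma> \<equiv> 2 * pi * \<i> * (\<Sum>p\<in>pts \<inter> box (Complex x0 y0) (Complex x1 y1). residue F p)"
  shows vertical_integral_residues_left:
    "(\<And>z. Re z = x0 \<Longrightarrow> y0 \<le> Im z \<Longrightarrow> Im z \<le> y1 \<Longrightarrow> norm (F z) \<le> B) \<Longrightarrow>
      norm (contour_integral (vertical_path x1 y0 y1) F - \<Sigma>) \<le> B * (2 * (x1 - x0) + (y1 - y0))"
    and vertical_integral_residues_right:
    "(\<And>z. Re z = x1 \<Longrightarrow> y0 \<le> Im z \<Longrightarrow> Im z \<le> y1 \<Longrightarrow> norm (F z) \<le> B) \<Longrightarrow>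
      norm (contour_integral (vertical_path x0 y0 y1) F + \<Sigma>) \<le> B * (2 * (x1 - x0) + (y1 - y0))"
proof -
  let ?I = "\<lambda>x. contour_integral (vertical_path x y0 y1) F"
  have diff: "norm (?I x1 - ?I x0 - \<Sigma>) \<le> 2 * B * (x1 - x0)"
    unfolding \<Sigma>_def by (rule vertical_integral_difference[OF xy S sub pts holo inside B])
  have side: "{z. Re z = x \<and> y0 \<le> Im z \<and> Im z \<le> y1} \<subseteq> S - pts" if "x = x0 \<or> x = x1" for x
    using sub inside that xy by (fastforce simp: in_cbox_complex_iff in_box_complex_iff)
  have cont: "continuous_on {z. Re z = x \<and> y0 \<le> Im z \<and> Im z \<le> y1} F" if "x = x0 \<or> x = x1" for x
    by (rule continuous_on_subset[OF holomorphic_on_imp_continuous_on[OF holo] side[OF that]])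
  show "norm (?I x1 - \<Sigma>) \<le> B * (2 * (x1 - x0) + (y1 - y0))"
    if "\<And>z. Re z = x0 \<Longrightarrow> y0 \<le> Im z \<Longrightarrow> Im z \<le> y1 \<Longrightarrow> norm (F z) \<le> B"
  proof -
    have "norm (?I x0) \<le> B * (y1 - y0)"
      using that by (intro vertical_integral_bound[OF xy(2) cont]) auto
    then have "norm ((?I x1 - ?I x0 - \<Sigma>) + ?I x0) \<le> 2 * B * (x1 - x0) + B * (y1 - y0)"
      using diff by (intro norm_triangle_le) linarith
    then show ?thesis by (simp add: algebra_simps)
  qed
  show "norm (?I x0 + \<Sigma>) \<le> B * (2 * (x1 - x0) + (y1 - y0))"
    if "\<And>z. Re z = x1 \<Longrightarrow> y0 \<le> Im z \<Longrightarrow> Im z \<le> y1 \<Longrightarrow> norm (F z) \<le> B"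
  proof -
    have "norm (?I x1) \<le> B * (y1 - y0)"
      using that by (intro vertical_integral_bound[OF xy(2) cont]) auto
    then have "norm (?I x1 - (?I x1 - ?I x0 - \<Sigma>)) \<le> B * (y1 - y0) + 2 * B * (x1 - x0)"
      using diff norm_triangle_ineq4[of "?I x1" "?I x1 - ?I x0 - \<Sigma>"] by linarith
    then show ?thesis by (simp add: algebra_simps)
  qed
qed

text \<open>The residue at an at most simple pole of \<open>B\<close>, where \<open>A\<close> is regular.\<close>

lemma residue_mult_simple:
  assumes "open S" "z \<in> S" "(\<lambda>s. A s * B s) holomorphic_on S - {z}"
    and "isCont A z" "((\<lambda>s. B s * (s - z)) \<longlongrightarrow> b) (at z)"
  shows "residue (\<lambda>s. A s * B s) z = A z * b"
proof (rule residue_simple'[OF assms(1-3)])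
  have "((\<lambda>s. A s * (B s * (s - z))) \<longlongrightarrow> A z * b) (at z)"
    using assms(4,5) by (intro tendsto_mult) (auto simp: isCont_def)
  then show "((\<lambda>s. A s * B s * (s - z)) \<longlongrightarrow> A z * b) (at z)" by (simp add: mult.assoc)
qed

section \<open>The Mellin kernel of a monophase volume function\<close>

text \<open>Let \<open>P x = (\<Sum>k<d. \<kappa> k * x ^ (d - k))\<close>.  The kernel is the integral against \<open>x powr (s - d - 1)\<close>
  over \<open>x > 0\<close>, a Mellin transform, of the function equal to \<open>P x\<close> for \<open>x \<le> g\<close> and to \<open>P g\<close> for
  \<open>x \<ge> g\<close>, if \<open>d - 1 < Re s < d\<close>.  Inversely, for \<open>d - 1 < \<sigma> < d\<close>, integrating
  \<open>x powr (d - s) * tube_kernel d g \<kappa> s / (2 * pi * \<i>)\<close> over the line \<open>Re s = \<sigma>\<close> returns that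
  function.  Continuity at \<open>x = g\<close> is what makes the kernel decay quadratically: each summand
  is \<open>\<kappa> k * g powr (s - k)\<close> times \<open>1 / (s - k) - 1 / (s - d)\<close>.\<close>

definition tube_kernel :: "nat \<Rightarrow> real \<Rightarrow> (nat \<Rightarrow> real) \<Rightarrow> complex \<Rightarrow> complex" where
  "tube_kernel d g \<kappa> s = (\<Sum>k<d. of_real (\<kappa> k) * of_real g powr (s - of_nat k) * of_nat (d - k)
      / ((s - of_nat k) * (of_nat d - s)))"

lemma tube_kernel_holomorphic:
  assumes "0 < g"
  shows "tube_kernel d g \<kappa> holomorphic_on - (of_nat ` {..d})"
proof -
  have "(s - of_nat k) * (of_nat d - s) \<noteq> 0" if "s \<in> - (of_nat ` {..d})" "k < d" for s :: complex and k
    using that by (auto simp: image_iff)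
  then show ?thesis
    unfolding tube_kernel_def[abs_def] using assms
    by (intro holomorphic_intros) auto
qed

lemma tube_kernel_bound:
  assumes "0 < g" "0 < R" "\<And>k. k \<le> d \<Longrightarrow> R / 2 \<le> norm (s - of_nat k)"
  shows "norm (tube_kernel d g \<kappa> s) \<le>
    4 * (\<Sum>k<d. \<bar>\<kappa> k\<bar> * g powr - real k * real (d - k)) * g powr Re s / R ^ 2"
proof -
  have "norm (tube_kernel d g \<kappa> s) \<le> (\<Sum>k<d. 4 * (\<bar>\<kappa> k\<bar> * g powr - real k * real (d - k)) * g powr Re s / R ^ 2)"
    unfolding tube_kernel_def
  proof (rule sum_norm_le)
    fix k assume "k \<in> {..<d}"
    then have "R / 2 \<le> norm (s - of_nat k)" "R / 2 \<le> norm (of_nat d - s)"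
      using assms(3)[of k] assms(3)[of d] by (auto simp: norm_minus_commute)
    then have "(R / 2) * (R / 2) \<le> norm ((s - of_nat k) * (of_nat d - s))"
      unfolding norm_mult using assms(2) by (intro mult_mono) auto
    then have le: "R\<^sup>2 / 4 \<le> norm ((s - of_nat k) * (of_nat d - s))" by (simp add: power2_eq_square)
    have "norm (of_real (\<kappa> k) * of_real g powr (s - of_nat k) * of_nat (d - k) / ((s - of_nat k) * (of_nat d - s)))
        = \<bar>\<kappa> k\<bar> * (g powr - real k * g powr Re s) * real (d - k) / norm ((s - of_nat k) * (of_nat d - s))"
      using assms(1) by (simp add: norm_mult norm_divide norm_powr_real_powr flip: powr_add)
    also have "\<dots> \<le> \<bar>\<kappa> k\<bar> * (g powr - real k * g powr Re s) * real (d - k) / (R\<^sup>2 / 4)"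
      using le assms(2) by (intro divide_left_mono mult_nonneg_nonneg mult_pos_pos)
        (auto intro: less_le_trans[of 0 "R\<^sup>2/4"])
    finally show "norm (of_real (\<kappa> k) * of_real g powr (s - of_nat k) * of_nat (d - k) / ((s - of_nat k) * (of_nat d - s)))
        \<le> 4 * (\<bar>\<kappa> k\<bar> * g powr - real k * real (d - k)) * g powr Re s / R ^ 2"
      by (simp add: mult_ac)
  qed
  also have "\<dots> = 4 * (\<Sum>k<d. \<bar>\<kappa> k\<bar> * g powr - real k * real (d - k)) * g powr Re s / R ^ 2"
    by (simp add: sum_distrib_left sum_distrib_right sum_divide_distrib)
  finally show ?thesis .
qed

lemma tube_kernel_simple_pole:
  assumes "0 < g" "k < d"
  shows "((\<lambda>s. tube_kernel d g \<kappa> s * (s - of_nat k)) \<longlongrightarrow> of_real (\<kappa> k)) (at (of_nat k))"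
proof -
  let ?t = "\<lambda>j s. of_real (\<kappa> j) * of_real g powr (s - of_nat j) * of_nat (d - j)
      / ((s - of_nat j) * (of_nat d - s)) :: complex"
  have "((\<lambda>s. ?t j s * (s - of_nat k)) \<longlongrightarrow> (if j = k then of_real (\<kappa> k) else 0)) (at (of_nat k))"
    if "j < d" for j
  proof (cases "j = k")
    case True
    have "((\<lambda>s. of_real (\<kappa> k) * of_real g powr (s - of_nat k) * of_nat (d - k) / (of_nat d - s))
        \<longlongrightarrow> of_real (\<kappa> k) * of_real g powr (of_nat k - of_nat k) * of_nat (d - k) / (of_nat d - of_nat k)) (at (of_nat k :: complex))"
      using assms by (intro tendsto_intros) auto
    also have "of_real (\<kappa> k) * of_real g powr (of_nat k - of_nat k) * of_nat (d - k) / (of_nat d - of_nat k)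
        = (of_real (\<kappa> k) :: complex)"
      using assms by (simp add: of_nat_diff)
    finally have "((\<lambda>s. ?t k s * (s - of_nat k)) \<longlongrightarrow> of_real (\<kappa> k)) (at (of_nat k))"
      by (rule Lim_transform_eventually) (auto simp: eventually_at_filter)
    then show ?thesis using True by simp
  next
    case False
    have "((\<lambda>s. ?t j s * (s - of_nat k)) \<longlongrightarrow> ?t j (of_nat k) * (of_nat k - of_nat k)) (at (of_nat k))"
      using assms False by (intro tendsto_intros) auto
    then show ?thesis using False by simp
  qed
  then have "((\<lambda>s. \<Sum>j<d. ?t j s * (s - of_nat k)) \<longlongrightarrow> (\<Sum>j<d. if j = k then of_real (\<kappa> k) else 0)) (at (of_nat k))"
    by (intro tendsto_sum) auto
  then show ?thesis using assms(2)
    by (simp add: tube_kernel_def sum_distrib_right)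
qed

lemma tube_kernel_simple_pole_d:
  assumes "0 < g"
  shows "((\<lambda>s. tube_kernel d g \<kappa> s * (s - of_nat d)) \<longlongrightarrow> - of_real (\<Sum>k<d. \<kappa> k * g ^ (d - k))) (at (of_nat d))"
proof -
  let ?t = "\<lambda>j s. of_real (\<kappa> j) * of_real g powr (s - of_nat j) * of_nat (d - j)
      / ((s - of_nat j) * (of_nat d - s)) :: complex"
  have "((\<lambda>s. ?t j s * (s - of_nat d)) \<longlongrightarrow> - of_real (\<kappa> j * g ^ (d - j))) (at (of_nat d))" if "j < d" for j
  proof -
    have "((\<lambda>s. - (of_real (\<kappa> j) * of_real g powr (s - of_nat j) * of_nat (d - j) / (s - of_nat j)))
        \<longlongrightarrow> - (of_real (\<kappa> j) * of_real g powr (of_nat d - of_nat j) * of_nat (d - j) / (of_nat d - of_nat j))) (at (of_nat d :: complex))"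
      using assms that by (intro tendsto_intros) auto
    also have "of_real (\<kappa> j) * of_real g powr (of_nat d - of_nat j) * of_nat (d - j) / (of_nat d - of_nat j)
        = (of_real (\<kappa> j * g ^ (d - j)) :: complex)"
    proof -
      have "(of_nat d - of_nat j :: complex) = of_nat (d - j)" using that by (simp add: of_nat_diff)
      moreover have "(of_nat (d - j) :: complex) \<noteq> 0" using that by simp
      ultimately show ?thesis using assms by (simp del: of_nat_diff)
    qed
    finally show ?thesis
      by (rule Lim_transform_eventually)
         (auto simp: eventually_at_filter divide_simps, simp add: algebra_simps)
  qed
  then have "((\<lambda>s. \<Sum>j<d. ?t j s * (s - of_nat d)) \<longlongrightarrow> (\<Sum>j<d. - of_real (\<kappa> j * g ^ (d - j)))) (at (of_nat d))"
    by (intro tendsto_sum) auto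
  then show ?thesis by (simp add: tube_kernel_def sum_distrib_right sum_negf)
qed


section \<open>Truncated Mellin inversion\<close>

text \<open>The factor \<open>(g / x) powr Re s\<close> is largest on the line \<open>Re s = \<sigma>\<close> if the contour is closed to the
  left when \<open>x \<le> g\<close> and to the right when \<open>x \<ge> g\<close>.  Hence the bound holds on the whole contour,
  and it is uniform near \<open>x = g\<close>.\<close>

lemma tube_integrand_bound:
  assumes x: "0 < x" and g: "0 < g" and R: "0 < R"
    and far: "\<And>k. k \<le> d \<Longrightarrow> R / 2 \<le> norm (s - of_nat k)"
    and A: "norm a \<le> M"
    and side: "x \<le> g \<and> Re s \<le> \<sigma> \<or> g \<le> x \<and> \<sigma> \<le> Re s"
  shows "norm (of_real x powr (of_nat d - s) * a * tube_kernel d g \<kappa> s) \<le>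
    4 * M * (\<Sum>k<d. \<bar>\<kappa> k\<bar> * g powr - real k * real (d - k)) * g powr \<sigma> * x powr (real d - \<sigma>) / R ^ 2"
proof -
  let ?K = "\<Sum>k<d. \<bar>\<kappa> k\<bar> * g powr - real k * real (d - k)"
  have K: "0 \<le> ?K" by (intro sum_nonneg) auto
  have M: "0 \<le> M" using A norm_ge_zero order_trans by blast
  have "(g / x) powr Re s \<le> (g / x) powr \<sigma>"
    using side
  proof
    assume "x \<le> g \<and> Re s \<le> \<sigma>"
    then show ?thesis using x by (intro powr_mono) auto
  next
    assume "g \<le> x \<and> \<sigma> \<le> Re s"
    then show ?thesis using x g by (intro powr_mono') auto
  qed
  then have "x powr real d * (g / x) powr Re s \<le> x powr real d * (g / x) powr \<sigma>"
    by (intro mult_left_mono) auto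
  then have le: "x powr (real d - Re s) * g powr Re s \<le> x powr (real d - \<sigma>) * g powr \<sigma>"
    using x g by (simp add: powr_divide powr_diff)
  have "norm (of_real x powr (of_nat d - s) * a * tube_kernel d g \<kappa> s)
      = x powr (real d - Re s) * norm a * norm (tube_kernel d g \<kappa> s)"
    using x by (simp add: norm_mult norm_powr_real_powr)
  also have "\<dots> \<le> x powr (real d - Re s) * M * (4 * ?K * g powr Re s / R ^ 2)"
    using tube_kernel_bound[OF g R far, where \<kappa>=\<kappa>] A M by (intro mult_mono) auto
  also have "\<dots> = 4 * M * ?K / R ^ 2 * (x powr (real d - Re s) * g powr Re s)" by simp
  also have "\<dots> \<le> 4 * M * ?K / R ^ 2 * (x powr (real d - \<sigma>) * g powr \<sigma>)"
    using le K M by (intro mult_left_mono) auto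
  finally show ?thesis by (simp add: mult_ac)
qed

lemma far_from_integers:
  assumes "0 \<le> \<sigma>" "\<sigma> \<le> real d" "2 * real d \<le> R" "k \<le> d"
    and s: "R \<le> \<bar>Im s\<bar> \<or> Re s = \<sigma> - R \<or> Re s = \<sigma> + R"
  shows "R / 2 \<le> norm (s - of_nat k)"
proof -
  have k: "real k \<le> real d" using assms(4) by simp
  have "\<bar>Im s\<bar> \<le> norm (s - of_nat k)" "\<bar>Re s - real k\<bar> \<le> norm (s - of_nat k)"
    using abs_Im_le_cmod[of "s - of_nat k"] abs_Re_le_cmod[of "s - of_nat k"] by auto
  then show ?thesis using s assms(1-3) k by linarith
qed

text \<open>The segment on the line \<open>Re s = \<sigma>\<close> is closed to a rectangle of width \<open>R\<close> on its left.  The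
  perimeter is of order \<open>R\<close> and the kernel of order \<open>1 / R\<^sup>2\<close>, so the value is the sum of the
  residues up to an error of order \<open>1 / R\<close>.  The factor \<open>A\<close> is allowed simple poles in \<open>Z\<close>, with
  residues \<open>\<rho>\<close>; it is used with \<open>A = 1\<close> and with the scaling zeta function.\<close>

lemma tube_integral_shift_left:
  fixes Z :: "complex set"
  assumes x: "0 < x" "x \<le> g" and g: "0 < g" and d: "1 \<le> d"
    and \<sigma>: "real d - 1 < \<sigma>" "\<sigma> < real d"
    and y: "y0 \<le> - R" "R \<le> y1" "y1 - y0 \<le> 3 * R" and R: "2 * real d \<le> R"
    and Z: "finite Z" "Z \<inter> of_nat ` {..d} = {}"
    and A: "A holomorphic_on {s. y0 - 1 < Im s \<and> Im s < y1 + 1} - Z"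
    and inside: "\<And>\<omega>. \<omega> \<in> Z \<Longrightarrow> y0 \<le> Im \<omega> \<Longrightarrow> Im \<omega> \<le> y1 \<Longrightarrow>
      \<sigma> - R < Re \<omega> \<and> Re \<omega> < \<sigma> \<and> y0 < Im \<omega> \<and> Im \<omega> < y1"
    and res: "\<And>\<omega>. \<omega> \<in> Z \<Longrightarrow> ((\<lambda>s. A s * (s - \<omega>)) \<longlongrightarrow> \<rho> \<omega>) (at \<omega>)"
    and bound: "\<And>s. y0 \<le> Im s \<Longrightarrow> Im s \<le> y1 \<Longrightarrow> Im s = y0 \<or> Im s = y1 \<or> Re s = \<sigma> - R \<Longrightarrow> norm (A s) \<le> M"
  shows "norm (contour_integral (vertical_path \<sigma> y0 y1)
        (\<lambda>s. of_real x powr (of_nat d - s) * A s * tube_kernel d g \<kappa> s)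
      - 2 * pi * \<i> * ((\<Sum>k<d. of_real (\<kappa> k) * A (of_nat k) * of_real x ^ (d - k))
         + (\<Sum>\<omega> | \<omega> \<in> Z \<and> y0 < Im \<omega> \<and> Im \<omega> < y1. \<rho> \<omega> * of_real x powr (of_nat d - \<omega>) * tube_kernel d g \<kappa> \<omega>)))
    \<le> 20 * M * (\<Sum>k<d. \<bar>\<kappa> k\<bar> * g powr - real k * real (d - k)) * g powr \<sigma> * x powr (real d - \<sigma>) / R"
proof -
  let ?E = "tube_kernel d g \<kappa>"
  let ?F = "\<lambda>s. of_real x powr (of_nat d - s) * A s * ?E s"
  let ?K = "\<Sum>k<d. \<bar>\<kappa> k\<bar> * g powr - real k * real (d - k)"
  define B where "B = 4 * M * ?K * g powr \<sigma> * x powr (real d - \<sigma>) / R ^ 2"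
  \<comment> \<open>A neighbourhood of the rectangle that avoids the pole of the kernel at \<open>d\<close>.\<close>
  define S where "S = {s. Re s < real d} \<inter> {s. y0 - 1 < Im s} \<inter> {s. Im s < y1 + 1}"
  define I :: "complex set" where "I = of_nat ` {..<d}"
  define pts where "pts = I \<union> Z"
  define Q where "Q = box (Complex (\<sigma> - R) y0) (Complex \<sigma> y1)"
  have R0: "0 < R" using R d by linarith
  have \<sigma>0: "0 \<le> \<sigma>" using \<sigma> d by linarith
  have oS: "open S" unfolding S_def
    by (intro open_Int open_halfspace_Re_lt open_halfspace_Im_gt open_halfspace_Im_lt)
  have cS: "connected S" unfolding S_def
    by (intro convex_connected convex_Int convex_halfspace_Re_lt convex_halfspace_Im_gt convex_halfspace_Im_lt)
  have holE: "?E holomorphic_on S - I"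
    by (rule holomorphic_on_subset[OF tube_kernel_holomorphic[OF g]]) (auto simp: S_def I_def image_iff)
  have holA: "A holomorphic_on S - Z"
    by (rule holomorphic_on_subset[OF A]) (auto simp: S_def)
  have holF: "?F holomorphic_on S - pts"
    using x(1) unfolding pts_def
    by (intro holomorphic_intros holomorphic_on_subset[OF holA] holomorphic_on_subset[OF holE]) auto
  have fin: "finite pts" using Z(1) by (simp add: pts_def I_def)
  have I_in: "I \<subseteq> Q" using \<sigma> R y R0
    by (auto simp: I_def Q_def in_box_complex_iff)
  have ptsQ: "pts \<inter> cbox (Complex (\<sigma> - R) y0) (Complex \<sigma> y1) \<subseteq> Q"
    using I_in inside by (auto simp: pts_def Q_def in_box_complex_iff in_cbox_complex_iff)
  have far: "R / 2 \<le> norm (s - of_nat k)" if "Im s = y0 \<or> Im s = y1 \<or> Re s = \<sigma> - R" "k \<le> d" for s k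
    using that y R0 by (intro far_from_integers[OF \<sigma>0 less_imp_le[OF \<sigma>(2)] R]) auto
  have B: "norm (?F s) \<le> B" if "y0 \<le> Im s" "Im s \<le> y1" "Re s \<le> \<sigma>" "Im s = y0 \<or> Im s = y1 \<or> Re s = \<sigma> - R" for s
    unfolding B_def using that x far[OF that(4)]
    by (intro tube_integrand_bound[OF x(1) g R0] bound) auto
  have "norm (contour_integral (vertical_path \<sigma> y0 y1) ?F - 2 * pi * \<i> * (\<Sum>p\<in>pts \<inter> Q. residue ?F p))
      \<le> B * (2 * (\<sigma> - (\<sigma> - R)) + (y1 - y0))"
    unfolding Q_def
  proof (rule vertical_integral_residues_left[OF _ _ oS cS _ fin holF])
    show "cbox (Complex (\<sigma> - R) y0) (Complex \<sigma> y1) \<subseteq> S"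
      using \<sigma> by (auto simp: S_def in_cbox_complex_iff)
  qed (use R0 y B ptsQ in \<open>auto simp: Q_def\<close>)
  also have "\<dots> \<le> B * (5 * R)"
  proof (rule mult_left_mono)
    show "0 \<le> B" using B[of "Complex (\<sigma> - R) y0"] y R0 by (auto intro: order_trans[OF norm_ge_zero])
  qed (use y in auto)
  also have "\<dots> = 20 * M * ?K * g powr \<sigma> * x powr (real d - \<sigma>) / R"
    using R0 by (simp add: B_def power2_eq_square)
  also have "(\<Sum>p\<in>pts \<inter> Q. residue ?F p) = (\<Sum>p\<in>I. residue ?F p) + (\<Sum>p\<in>Z \<inter> Q. residue ?F p)"
  proof -
    have "pts \<inter> Q = I \<union> (Z \<inter> Q)" using I_in by (auto simp: pts_def)
    moreover have "I \<inter> (Z \<inter> Q) = {}" using Z(2) by (auto simp: I_def)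
    ultimately show ?thesis using Z(1) by (simp add: sum.union_disjoint I_def)
  qed
  also have "(\<Sum>p\<in>I. residue ?F p) = (\<Sum>k<d. of_real (\<kappa> k) * A (of_nat k) * of_real x ^ (d - k))"
    unfolding I_def
  proof (subst sum.reindex)
    show "inj_on (of_nat :: nat \<Rightarrow> complex) {..<d}" by (simp add: inj_on_def)
    show "(\<Sum>k<d. (residue ?F \<circ> of_nat) k) = (\<Sum>k<d. of_real (\<kappa> k) * A (of_nat k) * of_real x ^ (d - k))"
    proof (rule sum.cong[OF refl])
      fix k assume "k \<in> {..<d}"
      then have k: "k < d" by simp
      let ?O = "S - (pts - {of_nat k})"
      have O: "open ?O" using oS fin by (intro open_Diff finite_imp_closed) auto
      have kS: "of_nat k \<in> S" using k y R0 by (auto simp: S_def)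
      have "of_nat k \<in> S - Z" using kS Z(2) k by auto
      moreover have "open (S - Z)" using oS Z(1) by (intro open_Diff finite_imp_closed) auto
      ultimately have "isCont A (of_nat k)"
        using holomorphic_on_imp_continuous_on[OF holA] continuous_on_eq_continuous_at by blast
      then have cont: "isCont (\<lambda>s. of_real x powr (of_nat d - s) * A s) (of_nat k)"
        using x(1) by (intro continuous_intros) auto
      have "residue ?F (of_nat k) = of_real x powr (of_nat d - of_nat k) * A (of_nat k) * of_real (\<kappa> k)"
      proof (rule residue_mult_simple[OF O _ _ cont tube_kernel_simple_pole[OF g k]])
        show "?F holomorphic_on ?O - {of_nat k}"
          by (rule holomorphic_on_subset[OF holF]) auto
      qed (use kS in auto)
      also have "of_real x powr (of_nat d - of_nat k) = (of_real x ^ (d - k) :: complex)"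
        using x(1) k by (metis of_nat_diff less_imp_le of_real_eq_0_iff powr_complexpow order_less_irrefl)
      finally show "(residue ?F \<circ> of_nat) k = of_real (\<kappa> k) * A (of_nat k) * of_real x ^ (d - k)"
        by simp
    qed
  qed
  also have "(\<Sum>p\<in>Z \<inter> Q. residue ?F p) = (\<Sum>\<omega> | \<omega> \<in> Z \<and> y0 < Im \<omega> \<and> Im \<omega> < y1.
      \<rho> \<omega> * of_real x powr (of_nat d - \<omega>) * ?E \<omega>)"
  proof (rule sum.cong)
    show "Z \<inter> Q = {\<omega>. \<omega> \<in> Z \<and> y0 < Im \<omega> \<and> Im \<omega> < y1}"
      using inside by (force simp: Q_def in_box_complex_iff)
    fix \<omega> assume "\<omega> \<in> {\<omega>. \<omega> \<in> Z \<and> y0 < Im \<omega> \<and> Im \<omega> < y1}"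
    then have \<omega>: "\<omega> \<in> Z" "y0 < Im \<omega>" "Im \<omega> < y1" by auto
    let ?O = "S - (pts - {\<omega>})"
    have O: "open ?O" using oS fin by (intro open_Diff finite_imp_closed) auto
    have \<omega>S: "\<omega> \<in> S" using inside[of \<omega>] \<omega> \<sigma> by (auto simp: S_def)
    have "\<omega> \<in> S - I" using \<omega>S Z(2) \<omega>(1) by (auto simp: I_def)
    moreover have "open (S - I)" using oS by (intro open_Diff finite_imp_closed) (auto simp: I_def)
    ultimately have "isCont ?E \<omega>"
      using holomorphic_on_imp_continuous_on[OF holE] continuous_on_eq_continuous_at by blast
    then have cont: "isCont (\<lambda>s. of_real x powr (of_nat d - s) * ?E s) \<omega>"
      using x(1) by (intro continuous_intros) auto
    have "residue (\<lambda>s. of_real x powr (of_nat d - s) * ?E s * A s) \<omega>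
        = of_real x powr (of_nat d - \<omega>) * ?E \<omega> * \<rho> \<omega>"
    proof (rule residue_mult_simple[OF O _ _ cont res[OF \<omega>(1)]])
      have "?F holomorphic_on ?O - {\<omega>}"
        by (rule holomorphic_on_subset[OF holF]) auto
      then show "(\<lambda>s. of_real x powr (of_nat d - s) * ?E s * A s) holomorphic_on ?O - {\<omega>}"
        by (simp add: mult_ac)
    qed (use \<omega>S in auto)
    then show "residue ?F \<omega> = \<rho> \<omega> * of_real x powr (of_nat d - \<omega>) * ?E \<omega>"
      by (simp add: mult_ac)
  qed
  finally show ?thesis .
qed

lemma tube_integral_small:
  assumes x: "0 < x" "x \<le> g" and g: "0 < g" and d: "1 \<le> d"
    and \<sigma>: "real d - 1 < \<sigma>" "\<sigma> < real d"
    and y: "y0 \<le> - R" "R \<le> y1" "y1 - y0 \<le> 3 * R" and R: "2 * real d \<le> R"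
  shows "norm (contour_integral (vertical_path \<sigma> y0 y1)
        (\<lambda>s. of_real x powr (of_nat d - s) * tube_kernel d g \<kappa> s)
      - 2 * pi * \<i> * of_real (\<Sum>k<d. \<kappa> k * x ^ (d - k)))
    \<le> 20 * (\<Sum>k<d. \<bar>\<kappa> k\<bar> * g powr - real k * real (d - k)) * g powr \<sigma> * x powr (real d - \<sigma>) / R"
  using tube_integral_shift_left[OF assms, of "{}" "\<lambda>_. 1" undefined 1 \<kappa>] by simp

text \<open>For \<open>x \<ge> g\<close> the rectangle lies to the right of the segment and encloses only the pole at \<open>d\<close>.\<close>

lemma tube_integral_large:
  assumes x: "g \<le> x" and g: "0 < g" and d: "1 \<le> d"
    and \<sigma>: "real d - 1 < \<sigma>" "\<sigma> < real d"
    and y: "y0 \<le> - R" "R \<le> y1" "y1 - y0 \<le> 3 * R" and R: "2 * real d \<le> R"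
  shows "norm (contour_integral (vertical_path \<sigma> y0 y1)
        (\<lambda>s. of_real x powr (of_nat d - s) * tube_kernel d g \<kappa> s)
      - 2 * pi * \<i> * of_real (\<Sum>k<d. \<kappa> k * g ^ (d - k)))
    \<le> 20 * (\<Sum>k<d. \<bar>\<kappa> k\<bar> * g powr - real k * real (d - k)) * g powr \<sigma> * x powr (real d - \<sigma>) / R"
proof -
  let ?E = "tube_kernel d g \<kappa>"
  let ?F = "\<lambda>s. of_real x powr (of_nat d - s) * ?E s"
  let ?K = "\<Sum>k<d. \<bar>\<kappa> k\<bar> * g powr - real k * real (d - k)"
  let ?P = "\<Sum>k<d. \<kappa> k * g ^ (d - k)"
  define B where "B = 4 * ?K * g powr \<sigma> * x powr (real d - \<sigma>) / R ^ 2"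
  define pts :: "complex set" where "pts = of_nat ` {..d}"
  define Q where "Q = box (Complex \<sigma> y0) (Complex (\<sigma> + R) y1)"
  have R0: "0 < R" using R d by linarith
  have x0: "0 < x" using x g by linarith
  have \<sigma>0: "0 \<le> \<sigma>" using \<sigma> d by linarith
  have holF: "?F holomorphic_on UNIV - pts"
    using x0 tube_kernel_holomorphic[OF g, of d \<kappa>] unfolding pts_def Compl_eq_Diff_UNIV
    by (intro holomorphic_intros) auto
  have fin: "finite pts" by (simp add: pts_def)
  \<comment> \<open>The other poles \<open>0\<close>, \<dots>, \<open>d - 1\<close> lie to the left of \<open>\<sigma>\<close>.\<close>
  have ptsQ: "pts \<inter> cbox (Complex \<sigma> y0) (Complex (\<sigma> + R) y1) \<subseteq> {of_nat d}"
    using \<sigma>(1) by (auto simp: pts_def in_cbox_complex_iff)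
  have dQ: "of_nat d \<in> Q" using \<sigma> R y R0 \<sigma>0 d by (auto simp: Q_def in_box_complex_iff)
  have far: "R / 2 \<le> norm (s - of_nat k)" if "Im s = y0 \<or> Im s = y1 \<or> Re s = \<sigma> + R" "k \<le> d" for s k
    using that y R0 by (intro far_from_integers[OF \<sigma>0 less_imp_le[OF \<sigma>(2)] R]) auto
  have B: "norm (?F s) \<le> B" if "y0 \<le> Im s" "Im s \<le> y1" "\<sigma> \<le> Re s" "Im s = y0 \<or> Im s = y1 \<or> Re s = \<sigma> + R" for s
    using tube_integrand_bound[OF x0 g R0, of d s 1 1 \<sigma> \<kappa>] far[OF that(4)] that x by (simp add: B_def)
  have "norm (contour_integral (vertical_path \<sigma> y0 y1) ?F + 2 * pi * \<i> * (\<Sum>p\<in>pts \<inter> Q. residue ?F p))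
      \<le> B * (2 * (\<sigma> + R - \<sigma>) + (y1 - y0))"
    unfolding Q_def
  proof (rule vertical_integral_residues_right[OF _ _ open_UNIV connected_UNIV _ fin holF])
    show "pts \<inter> cbox (Complex \<sigma> y0) (Complex (\<sigma> + R) y1) \<subseteq> box (Complex \<sigma> y0) (Complex (\<sigma> + R) y1)"
      using ptsQ dQ by (auto simp: Q_def)
  qed (use R0 y B in auto)
  also have "\<dots> \<le> B * (5 * R)"
  proof (rule mult_left_mono)
    show "0 \<le> B" using B[of "Complex (\<sigma> + R) y0"] y R0 by (auto intro: order_trans[OF norm_ge_zero])
  qed (use y in auto)
  also have "\<dots> = 20 * ?K * g powr \<sigma> * x powr (real d - \<sigma>) / R"
    using R0 by (simp add: B_def power2_eq_square)
  also have "pts \<inter> Q = {of_nat d}"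
    using ptsQ dQ box_subset_cbox by (auto simp: Q_def pts_def)
  also have "(\<Sum>p\<in>{of_nat d}. residue ?F p) = - of_real ?P"
  proof -
    let ?O = "UNIV - (pts - {of_nat d})"
    have O: "open ?O" using fin by (intro open_Diff finite_imp_closed) auto
    have "residue ?F (of_nat d) = of_real x powr (of_nat d - of_nat d) * - of_real ?P"
    proof (rule residue_mult_simple[OF O _ _ _ tube_kernel_simple_pole_d[OF g]])
      show "?F holomorphic_on ?O - {of_nat d}"
        by (rule holomorphic_on_subset[OF holF]) auto
      show "isCont (\<lambda>s. of_real x powr (of_nat d - s)) (of_nat d :: complex)"
        using x0 by (intro continuous_intros) auto
    qed auto
    then show ?thesis using x0 by simp
  qed
  finally show ?thesis by simp
qed

section \<open>The scaling zeta function\<close>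

text \<open>The entire function whose reciprocal is the scaling zeta function; its zeros are the complex
  dimensions.\<close>

definition moran_function :: "nat \<Rightarrow> (nat \<Rightarrow> real) \<Rightarrow> complex \<Rightarrow> complex" where
  "moran_function N r s = 1 - (\<Sum>n = 1..N. of_real (r n) powr s)"

lemma string_zeta_eq: "string_zeta N r s = 1 / moran_function N r s"
  by (simp add: string_zeta_def moran_function_def)

lemma moran_function_holomorphic:
  assumes "\<And>n. n \<in> {1..N} \<Longrightarrow> 0 < r n"
  shows "moran_function N r holomorphic_on S"
  unfolding moran_function_def[abs_def] using assms
  by (intro holomorphic_intros) (force simp: complex_nonpos_Reals_iff)+

lemma norm_ratio_sum_le:
  assumes "\<forall>n\<in>{1..N}. 0 < r n \<and> r n < 1" and "\<sigma> \<le> Re s"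
  shows "norm (\<Sum>n = 1..N. complex_of_real (r n) powr s) \<le> (\<Sum>n = 1..N. r n powr \<sigma>)"
proof (rule sum_norm_le)
  fix n assume n: "n \<in> {1..N}"
  then have "norm (complex_of_real (r n) powr s) = r n powr Re s"
    using assms(1) by (simp add: norm_powr_real_powr less_imp_le)
  also have "\<dots> \<le> r n powr \<sigma>" using assms n by (intro powr_mono') (auto intro: less_imp_le)
  finally show "norm (complex_of_real (r n) powr s) \<le> r n powr \<sigma>" .
qed

lemma moran_function_lower_bound_right:
  assumes "\<forall>n\<in>{1..N}. 0 < r n \<and> r n < 1" and "\<sigma> \<le> Re s"
  shows "1 - (\<Sum>n = 1..N. r n powr \<sigma>) \<le> norm (moran_function N r s)"
proof -
  have "norm (1::complex) - norm (\<Sum>n = 1..N. complex_of_real (r n) powr s) \<le> norm (moran_function N r s)"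
    unfolding moran_function_def by (rule norm_triangle_ineq2)
  then show ?thesis using norm_ratio_sum_le[OF assms] by simp
qed

text \<open>Far to the left the terms with the smallest ratio dominate the sum.  All of them are equal, so
  they cannot cancel each other.\<close>

lemma moran_function_lower_bound_left:
  assumes r: "\<forall>n\<in>{1..N}. 0 < r n \<and> r n < 1" and N: "1 \<le> N"
  obtains L where "\<And>s. Re s \<le> L \<Longrightarrow> 1 \<le> norm (moran_function N r s)"
proof -
  define m where "m = Min (r ` {1..N})"
  have "m \<in> r ` {1..N}" unfolding m_def using N by (intro Min_in) auto
  then obtain n0 where n0: "n0 \<in> {1..N}" "r n0 = m" by auto
  have m: "0 < m" "m < 1" using r n0 by auto
  have m_le: "m \<le> r n" if "n \<in> {1..N}" for n unfolding m_def using that by simp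
  define I where "I = {n \<in> {1..N}. r n = m}"
  define J where "J = {n \<in> {1..N}. r n \<noteq> m}"
  have IJ: "{1..N} = I \<union> J" "I \<inter> J = {}" "finite I" "finite J" by (auto simp: I_def J_def)
  have "((\<lambda>\<alpha>. \<Sum>n\<in>J. (r n / m) powr \<alpha>) \<longlongrightarrow> (\<Sum>n\<in>J. 0)) at_bot"
  proof (rule tendsto_sum)
    fix n assume n: "n \<in> J"
    then have "m < r n" using m_le[of n] by (auto simp: J_def)
    then have base: "1 < r n / m" using m by simp
    have "((\<lambda>\<alpha>. b powr \<alpha>) \<longlongrightarrow> 0) at_bot" if "1 < b" for b :: real using that by real_asymp
    from this[OF base] show "((\<lambda>\<alpha>. (r n / m) powr \<alpha>) \<longlongrightarrow> 0) at_bot" .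
  qed
  then have "eventually (\<lambda>\<alpha>. (\<Sum>n\<in>J. (r n / m) powr \<alpha>) < 1 / 2) at_bot"
    by (intro order_tendstoD(2)) auto
  moreover have "filterlim (\<lambda>\<alpha>. m powr \<alpha>) at_top at_bot" using m by real_asymp
  then have "eventually (\<lambda>\<alpha>. 4 \<le> m powr \<alpha>) at_bot" by (simp add: filterlim_at_top)
  ultimately have "eventually (\<lambda>\<alpha>. (\<Sum>n\<in>J. (r n / m) powr \<alpha>) < 1 / 2 \<and> 4 \<le> m powr \<alpha>) at_bot"
    by (rule eventually_conj)
  then obtain L where L: "\<And>\<alpha>. \<alpha> \<le> L \<Longrightarrow> (\<Sum>n\<in>J. (r n / m) powr \<alpha>) < 1 / 2 \<and> 4 \<le> m powr \<alpha>"
    by (auto simp: eventually_at_bot_linorder)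
  show ?thesis
  proof
    fix s :: complex assume "Re s \<le> L"
    note Ls = L[OF this]
    have "norm (\<Sum>n\<in>J. complex_of_real (r n) powr s) \<le> (\<Sum>n\<in>J. m powr Re s * (r n / m) powr Re s)"
    proof (rule sum_norm_le)
      fix n assume "n \<in> J"
      then have "0 < r n" using r by (simp add: J_def)
      then show "norm (complex_of_real (r n) powr s) \<le> m powr Re s * (r n / m) powr Re s"
        using m by (simp add: norm_powr_real_powr powr_divide)
    qed
    also have "\<dots> \<le> m powr Re s * (1 / 2)"
      unfolding sum_distrib_left[symmetric] using Ls by (intro mult_left_mono) auto
    finally have J: "norm (\<Sum>n\<in>J. complex_of_real (r n) powr s) \<le> m powr Re s * (1 / 2)" .
    have "(\<Sum>n\<in>I. complex_of_real (r n) powr s) = of_nat (card I) * complex_of_real m powr s"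
      by (simp add: I_def)
    then have "norm (\<Sum>n\<in>I. complex_of_real (r n) powr s) = card I * m powr Re s"
      using m by (simp add: norm_mult norm_powr_real_powr)
    moreover have "1 \<le> card I" using n0 IJ(3) by (auto simp: I_def Suc_le_eq card_gt_0_iff)
    ultimately have I: "m powr Re s \<le> norm (\<Sum>n\<in>I. complex_of_real (r n) powr s)"
      using m mult_right_mono[of 1 "real (card I)" "m powr Re s"] by simp
    have "moran_function N r s = 1 - ((\<Sum>n\<in>I. complex_of_real (r n) powr s) + (\<Sum>n\<in>J. complex_of_real (r n) powr s))"
      unfolding moran_function_def IJ(1) using IJ by (subst sum.union_disjoint) auto
    then have "(\<Sum>n\<in>I. complex_of_real (r n) powr s) = (1 - (\<Sum>n\<in>J. complex_of_real (r n) powr s)) - moran_function N r s"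
      by simp
    then have "norm (\<Sum>n\<in>I. complex_of_real (r n) powr s)
        \<le> 1 + norm (\<Sum>n\<in>J. complex_of_real (r n) powr s) + norm (moran_function N r s)"
      by (metis (no_types) norm_triangle_le_diff norm_triangle_ineq4 norm_one add_mono order_refl)
    then show "1 \<le> norm (moran_function N r s)" using I J Ls by linarith
  qed
qed

lemma moran_zeros:
  assumes r: "\<forall>n\<in>{1..N}. 0 < r n \<and> r n < 1" and N: "1 \<le> N"
    and \<sigma>: "(\<Sum>n = 1..N. r n powr \<sigma>) < 1"
  shows moran_zero_Re_less: "moran_function N r \<omega> = 0 \<Longrightarrow> Re \<omega> < \<sigma>"
    and finite_moran_zeros: "finite {\<omega>. moran_function N r \<omega> = 0 \<and> a \<le> Im \<omega> \<and> Im \<omega> \<le> b}"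
    and string_poles_eq: "string_poles N r = {\<omega>. moran_function N r \<omega> = 0}"
proof -
  obtain L where L: "\<And>s. Re s \<le> L \<Longrightarrow> 1 \<le> norm (moran_function N r s)"
    using moran_function_lower_bound_left[OF r N] by blast
  have right: "Re \<omega> < \<sigma>" if "moran_function N r \<omega> = 0" for \<omega>
    using moran_function_lower_bound_right[OF r, of \<sigma> \<omega>] \<sigma> that by force
  then show "moran_function N r \<omega> = 0 \<Longrightarrow> Re \<omega> < \<sigma>" .
  have left: "L < Re \<omega>" if "moran_function N r \<omega> = 0" for \<omega>
    using L[of \<omega>] that by force
  have hol: "moran_function N r holomorphic_on UNIV"
    by (rule moran_function_holomorphic) (use r in auto)
  have "\<not> moran_function N r constant_on UNIV"
  proof
    assume "moran_function N r constant_on UNIV"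
    then have "moran_function N r (of_real \<sigma>) = moran_function N r 0"
      by (metis UNIV_I constant_on_def)
    moreover have "(\<Sum>n = 1..N. complex_of_real (r n) powr 0) = (\<Sum>n = 1..N. 1)"
      using r by (intro sum.cong) force+
    ultimately have "(\<Sum>n = 1..N. complex_of_real (r n) powr of_real \<sigma>) = of_nat N"
      by (simp add: moran_function_def)
    then show False
      using norm_ratio_sum_le[OF r, of \<sigma> "of_real \<sigma>"] \<sigma> N by simp
  qed
  then have fin: "finite {\<omega>\<in>K. moran_function N r \<omega> = 0}" if "compact K" for K
    using holomorphic_compact_finite_zeros[OF hol] that by auto
  have "{\<omega>. moran_function N r \<omega> = 0 \<and> a \<le> Im \<omega> \<and> Im \<omega> \<le> b}
      \<subseteq> {\<omega> \<in> cbox (Complex L a) (Complex \<sigma> b). moran_function N r \<omega> = 0}"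
    using left right by (force simp: in_cbox_complex_iff)
  then show "finite {\<omega>. moran_function N r \<omega> = 0 \<and> a \<le> Im \<omega> \<and> Im \<omega> \<le> b}"
    using fin[OF compact_cbox] finite_subset by blast
  have cont: "moran_function N r \<midarrow>z\<rightarrow> moran_function N r z" for z
    using holomorphic_on_imp_continuous_on[OF hol] by (simp add: continuous_on_eq_continuous_at isCont_def)
  have "isolated_zero (moran_function N r) z \<longleftrightarrow> moran_function N r z = 0" for z
  proof -
    have "finite ({\<omega>\<in>cball z 1. moran_function N r \<omega> = 0} - {z})" using fin[OF compact_cball] by blast
    then have "eventually (\<lambda>w. w \<in> ball z 1 - ({\<omega>\<in>cball z 1. moran_function N r \<omega> = 0} - {z})) (nhds z)"
      by (intro eventually_nhds_in_open open_Diff finite_imp_closed) auto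
    then have "eventually (\<lambda>w. moran_function N r w \<noteq> 0) (at z)"
      unfolding eventually_at_filter by eventually_elim auto
    then show ?thesis
      using cont[of z] tendsto_unique[OF _ cont[of z], of 0] by (auto simp: isolated_zero_def)
  qed
  then show "string_poles N r = {\<omega>. moran_function N r \<omega> = 0}"
    by (simp add: string_poles_def string_zeta_eq[abs_def] is_pole_inverse_iff flip: inverse_eq_divide)
qed

lemma exists_contraction_exponent:
  assumes "\<And>n. n \<in> {1..N} \<Longrightarrow> 0 < r n" and "(\<Sum>n = 1..N. r n ^ d) < 1"
  obtains \<sigma> where "real d - 1 < \<sigma>" "\<sigma> < real d" "(\<Sum>n = 1..N. r n powr \<sigma>) < 1"
proof -
  have "((\<lambda>\<sigma>. \<Sum>n = 1..N. r n powr \<sigma>) \<longlongrightarrow> (\<Sum>n = 1..N. r n powr real d)) (at_left (real d))"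
    using assms(1) by (intro tendsto_sum tendsto_powr tendsto_const tendsto_ident_at) force
  moreover have "(\<Sum>n = 1..N. r n powr real d) = (\<Sum>n = 1..N. r n ^ d)"
    using assms(1) by (intro sum.cong) (auto simp: powr_realpow)
  then have "(\<Sum>n = 1..N. r n powr real d) < 1" using assms(2) by simp
  ultimately have "eventually (\<lambda>\<sigma>. (\<Sum>n = 1..N. r n powr \<sigma>) < 1) (at_left (real d))"
    by (rule order_tendstoD)
  moreover have "eventually (\<lambda>\<sigma>. \<sigma> \<in> {real d - 1<..<real d}) (at_left (real d))"
    by (rule eventually_at_left_real) simp
  ultimately have "eventually (\<lambda>\<sigma>. \<sigma> \<in> {real d - 1<..<real d} \<and> (\<Sum>n = 1..N. r n powr \<sigma>) < 1) (at_left (real d))"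
    by eventually_elim simp
  then show ?thesis using that eventually_happens'[OF trivial_limit_at_left_real] by fastforce
qed

text \<open>On a horizontal line on which the zeta function is bounded, the modulus of \<open>moran_function\<close> is
  at every point either \<open>0\<close> or bounded below, and it is nonzero far to the right; by continuity
  it vanishes nowhere.  The bound alone would not exclude a pole on the line at once, since
  \<open>string_zeta\<close> has the value \<open>0\<close> at its poles.\<close>

lemma languid_no_pole:
  assumes r: "\<forall>n\<in>{1..N}. 0 < r n \<and> r n < 1"
    and \<sigma>: "(\<Sum>n = 1..N. r n powr \<sigma>) < 1"
    and bound: "\<And>\<alpha>. norm (string_zeta N r (Complex \<alpha> t)) \<le> c"
  shows "moran_function N r (Complex \<alpha> t) \<noteq> 0"
proof
  assume zero: "moran_function N r (Complex \<alpha> t) = 0"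
  let ?f = "\<lambda>\<alpha>. norm (moran_function N r (Complex \<alpha> t))"
  have alt: "?f \<alpha> = 0 \<or> 1 \<le> c * ?f \<alpha>" for \<alpha>
    using bound[of \<alpha>] by (auto simp: string_zeta_eq norm_divide divide_simps split: if_splits)
  have "moran_function N r holomorphic_on UNIV"
    by (rule moran_function_holomorphic) (use r in auto)
  then have "continuous_on UNIV (moran_function N r)" by (rule holomorphic_on_imp_continuous_on)
  then have cont: "continuous_on UNIV (\<lambda>\<alpha>. c * ?f \<alpha>)"
    by (intro continuous_intros continuous_on_compose2[of UNIV "moran_function N r" UNIV "\<lambda>\<alpha>. Complex \<alpha> t"])
       (auto simp: Complex_eq intro!: continuous_intros)
  \<comment> \<open>To the right of \<open>\<sigma>\<close> there are no zeros, so the modulus would have to pass from \<open>0\<close> to a value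
    of at least \<open>1 / c\<close>.\<close>
  define \<beta> where "\<beta> = max \<sigma> \<alpha>"
  have "?f \<beta> \<noteq> 0" using moran_function_lower_bound_right[OF r, of \<sigma> "Complex \<beta> t"] \<sigma>
    by (auto simp: \<beta>_def)
  then have "1 \<le> c * ?f \<beta>" using alt by blast
  moreover have "c * ?f \<alpha> = 0" using zero by simp
  ultimately have "\<exists>x\<ge>\<alpha>. x \<le> \<beta> \<and> c * ?f x = 1 / 2"
    by (intro IVT' continuous_on_subset[OF cont]) (auto simp: \<beta>_def)
  then obtain x where "c * ?f x = 1 / 2" by blast
  then show False using alt[of x] by auto
qed

section \<open>A renewal inequality\<close>

text \<open>If \<open>D\<close> satisfies the renewal equation up to an error \<open>\<eta> * x powr (d - \<sigma>)\<close>, then it is itself of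
  that size.  Iterating the equation \<open>M\<close> times multiplies the a priori bounds \<open>K1\<close> and
  \<open>K2 * x powr (d - \<sigma>)\<close> by the \<open>M\<close>-th powers of two numbers less than \<open>1\<close>.\<close>

lemma renewal_bound:
  fixes D :: "real \<Rightarrow> complex"
  assumes r: "\<And>n. n \<in> {1..N} \<Longrightarrow> 0 < r n"
    and p: "(\<Sum>n = 1..N. r n ^ d) < 1" and q: "(\<Sum>n = 1..N. r n powr \<sigma>) < 1"
    and step: "\<And>x. 0 < x \<Longrightarrow>
      norm (D x - (\<Sum>n = 1..N. of_real (r n ^ d) * D (x / r n))) \<le> \<eta> * x powr (real d - \<sigma>)"
    and apriori: "\<And>x. 0 < x \<Longrightarrow> norm (D x) \<le> K1 + K2 * x powr (real d - \<sigma>)"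
    and x: "0 < x"
  shows "norm (D x) \<le> \<eta> * x powr (real d - \<sigma>) / (1 - (\<Sum>n = 1..N. r n powr \<sigma>))"
proof -
  define p q where "p = (\<Sum>n = 1..N. r n ^ d)" and "q = (\<Sum>n = 1..N. r n powr \<sigma>)"
  have p01: "0 \<le> p" "p < 1" and q01: "0 \<le> q" "q < 1"
    using p q r by (auto simp: p_def q_def intro!: sum_nonneg intro: less_imp_le)
  have scale: "r n ^ d * (x / r n) powr (real d - \<sigma>) = r n powr \<sigma> * x powr (real d - \<sigma>)"
    if "n \<in> {1..N}" "0 < x" for n x
  proof -
    have "r n ^ d = r n powr real d" using r[OF that(1)] by (simp add: powr_realpow)
    then show ?thesis using r[OF that(1)] that(2) by (simp add: powr_divide powr_diff)
  qed
  have iter: "norm (D x) \<le> \<eta> * x powr (real d - \<sigma>) / (1 - q) + p ^ M * K1 + q ^ M * K2 * x powr (real d - \<sigma>)"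
    if "0 < x" for x M
    using that
  proof (induction M arbitrary: x)
    case 0
    have "0 \<le> \<eta> * x powr (real d - \<sigma>)" using step[OF 0] norm_ge_zero order_trans by blast
    then have "0 \<le> \<eta> * x powr (real d - \<sigma>) / (1 - q)" using q01 by simp
    then show ?case using apriori[OF 0] by simp
  next
    case (Suc M)
    let ?b = "\<lambda>x. \<eta> * x powr (real d - \<sigma>) / (1 - q) + p ^ M * K1 + q ^ M * K2 * x powr (real d - \<sigma>)"
    \<comment> \<open>The constant part of the bound is multiplied by \<open>p\<close>, and by \<open>scale\<close> the multiples of
      \<open>x powr (d - \<sigma>)\<close> are multiplied by \<open>q\<close>.\<close>
    have "norm (\<Sum>n = 1..N. of_real (r n ^ d) * D (x / r n)) \<le> (\<Sum>n = 1..N. r n ^ d * ?b (x / r n))"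
    proof (rule sum_norm_le)
      fix n assume n: "n \<in> {1..N}"
      have "norm (of_real (r n ^ d) * D (x / r n)) = r n ^ d * norm (D (x / r n))"
        using r[OF n] by (simp add: norm_mult norm_power)
      also have "\<dots> \<le> r n ^ d * ?b (x / r n)"
        using r[OF n] Suc by (intro mult_left_mono) auto
      finally show "norm (of_real (r n ^ d) * D (x / r n)) \<le> r n ^ d * ?b (x / r n)" .
    qed
    also have "\<dots> = (\<Sum>n = 1..N. \<eta> / (1 - q) * (r n ^ d * (x / r n) powr (real d - \<sigma>)) + r n ^ d * (p ^ M * K1)
        + q ^ M * K2 * (r n ^ d * (x / r n) powr (real d - \<sigma>)))"
      by (simp add: algebra_simps)
    also have "\<dots> = (\<Sum>n = 1..N. \<eta> / (1 - q) * (r n powr \<sigma> * x powr (real d - \<sigma>)) + r n ^ d * (p ^ M * K1)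
        + q ^ M * K2 * (r n powr \<sigma> * x powr (real d - \<sigma>)))"
      using scale Suc.prems by (intro sum.cong) auto
    also have "\<dots> = \<eta> / (1 - q) * (q * x powr (real d - \<sigma>)) + p * (p ^ M * K1)
        + q ^ M * K2 * (q * x powr (real d - \<sigma>))"
      by (simp add: sum.distrib p_def q_def sum_distrib_left sum_distrib_right)
    finally have "norm (\<Sum>n = 1..N. of_real (r n ^ d) * D (x / r n)) \<le> \<dots>" .
    then have "norm (D x) \<le> \<eta> * x powr (real d - \<sigma>) + \<dots>"
      using step[OF Suc.prems] norm_triangle_sub[of "D x" "\<Sum>n = 1..N. of_real (r n ^ d) * D (x / r n)"] by linarith
    also have "\<dots> = \<eta> * x powr (real d - \<sigma>) / (1 - q) + p ^ Suc M * K1 + q ^ Suc M * K2 * x powr (real d - \<sigma>)"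
      using q01 by (simp add: field_simps)
    finally show ?case .
  qed
  have "(\<lambda>M. \<eta> * x powr (real d - \<sigma>) / (1 - q) + p ^ M * K1 + q ^ M * K2 * x powr (real d - \<sigma>))
      \<longlonglongrightarrow> \<eta> * x powr (real d - \<sigma>) / (1 - q) + 0 * K1 + 0 * K2 * x powr (real d - \<sigma>)"
    using p01 q01 by (intro tendsto_intros LIMSEQ_realpow_zero)
  then have "norm (D x) \<le> \<eta> * x powr (real d - \<sigma>) / (1 - q) + 0 * K1 + 0 * K2 * x powr (real d - \<sigma>)"
    by (rule LIMSEQ_le_const) (use iter[OF x] in blast)
  then show ?thesis by (simp add: q_def)
qed

section \<open>The pointwise tube formula\<close>

lemma simple_pole_limit:
  assumes iso: "isolated_singularity_at f z" and pole: "is_pole f z" and order: "zorder f z = -1"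
  shows "((\<lambda>s. f s * (s - z)) \<longlongrightarrow> residue f z) (at z)"
proof -
  obtain e where e: "e > 0" "f holomorphic_on ball z e - {z}"
    using iso analytic_imp_holomorphic unfolding isolated_singularity_at_def by blast
  obtain r where "0 < r" "zor_poly f z holomorphic_on cball z r"
    using zorder_exist_pole[OF e(2) open_ball _ pole] e(1) by auto
  then have "isCont (zor_poly f z) z"
    using continuous_on_interior holomorphic_on_imp_continuous_on by fastforce
  then have "(zor_poly f z \<longlongrightarrow> residue f z) (at z)"
    using residue_simple_pole[OF assms] by (simp add: isCont_def)
  moreover have "eventually (\<lambda>s. zor_poly f z s = f s * (s - z)) (at z)"
    using zor_poly_pole_eq[OF iso pole] by (simp add: order)
  ultimately show ?thesis by (rule Lim_transform_eventually)
qed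

lemma string_zeta_holomorphic:
  assumes "\<forall>n\<in>{1..N}. 0 < r n" and "\<And>s. s \<in> S \<Longrightarrow> moran_function N r s \<noteq> 0"
  shows "string_zeta N r holomorphic_on S"
  unfolding string_zeta_eq[abs_def]
  using assms by (intro holomorphic_intros moran_function_holomorphic) auto

text \<open>The truncated inversion integrals \<open>J\<close> with the zeta factor satisfy exactly the renewal equation
  whose inhomogeneity is the truncated inversion integral of the kernel alone, because
  \<open>moran_function\<close> cancels the zeta function.\<close>

lemma zeta_line_integral:
  fixes \<kappa> :: "nat \<Rightarrow> real"
  assumes r: "\<forall>n\<in>{1..N}. 0 < r n \<and> r n < 1" and q: "(\<Sum>n = 1..N. r n powr \<sigma>) < 1"
    and g: "0 < g" and \<sigma>: "real d - 1 < \<sigma>" "\<sigma> < real d" and d: "1 \<le> d" and y: "y0 < y1"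
  defines "J \<equiv> \<lambda>x. contour_integral (vertical_path \<sigma> y0 y1)
      (\<lambda>s. of_real x powr (of_nat d - s) * string_zeta N r s * tube_kernel d g \<kappa> s)"
  shows zeta_line_integral_renewal: "0 < x \<Longrightarrow>
      J x - (\<Sum>n = 1..N. of_real (r n ^ d) * J (x / r n)) =
      contour_integral (vertical_path \<sigma> y0 y1) (\<lambda>s. of_real x powr (of_nat d - s) * tube_kernel d g \<kappa> s)"
    and zeta_line_integral_bound: "\<exists>K. \<forall>x>0. norm (J x) \<le> K * x powr (real d - \<sigma>)"
proof -
  let ?Z = "string_zeta N r" and ?E = "tube_kernel d g \<kappa>"
  let ?p = "vertical_path \<sigma> y0 y1"
  define L where "L = {s. Re s = \<sigma> \<and> y0 \<le> Im s \<and> Im s \<le> y1}"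
  have L: "path_image ?p = L" using y by (simp add: vertical_path_image L_def)
  have nz: "moran_function N r s \<noteq> 0" if "s \<in> L" for s
    using moran_function_lower_bound_right[OF r, of \<sigma> s] q that by (auto simp: L_def)
  have "?E holomorphic_on L"
  proof (rule holomorphic_on_subset[OF tube_kernel_holomorphic[OF g]])
    have "\<forall>k\<le>d. \<sigma> \<noteq> real k"
    proof (intro allI impI)
      fix k assume "k \<le> d"
      then show "\<sigma> \<noteq> real k" using \<sigma> by (cases "k = d") auto
    qed
    then show "L \<subseteq> - of_nat ` {..d}" by (auto simp: L_def)
  qed
  moreover have "?Z holomorphic_on L" using r nz by (intro string_zeta_holomorphic) auto
  ultimately have hol: "(\<lambda>s. ?Z s * ?E s) holomorphic_on L" by (intro holomorphic_intros)
  have int: "(\<lambda>s. of_real x powr (of_nat d - s) * ?Z s * ?E s) contour_integrable_on ?p" if "0 < x" for x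
  proof (rule contour_integrable_continuous_linepath)
    have "(\<lambda>s. of_real x powr (of_nat d - s) * (?Z s * ?E s)) holomorphic_on L"
      using that by (intro holomorphic_intros hol) auto
    then show "continuous_on (closed_segment (Complex \<sigma> y0) (Complex \<sigma> y1))
        (\<lambda>s. of_real x powr (of_nat d - s) * ?Z s * ?E s)"
      using L by (simp add: mult.assoc holomorphic_on_imp_continuous_on)
  qed
  show "J x - (\<Sum>n = 1..N. of_real (r n ^ d) * J (x / r n)) =
      contour_integral ?p (\<lambda>s. of_real x powr (of_nat d - s) * ?E s)" if x: "0 < x"
  proof -
    let ?f = "\<lambda>n s. of_real (x / r n) powr (of_nat d - s) * ?Z s * ?E s"
    have intn: "?f n contour_integrable_on ?p" if "n \<in> {1..N}" for n
      using int[of "x / r n"] x r that by simp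
    have "J x - (\<Sum>n = 1..N. of_real (r n ^ d) * J (x / r n)) =
        contour_integral ?p (\<lambda>s. of_real x powr (of_nat d - s) * ?Z s * ?E s)
        - contour_integral ?p (\<lambda>s. \<Sum>n = 1..N. of_real (r n ^ d) * ?f n s)"
    proof -
      have "(\<Sum>n = 1..N. of_real (r n ^ d) * contour_integral ?p (?f n))
          = (\<Sum>n = 1..N. contour_integral ?p (\<lambda>s. of_real (r n ^ d) * ?f n s))"
        using intn by (intro sum.cong refl contour_integral_lmul[symmetric])
      also have "\<dots> = contour_integral ?p (\<lambda>s. \<Sum>n = 1..N. of_real (r n ^ d) * ?f n s)"
        using intn by (intro contour_integral_sum[symmetric] contour_integrable_lmul) auto
      finally show ?thesis by (simp only: J_def)
    qed
    also have "\<dots> = contour_integral ?p (\<lambda>s. of_real x powr (of_nat d - s) * ?Z s * ?E s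
        - (\<Sum>n = 1..N. of_real (r n ^ d) * ?f n s))"
      using int[OF x] intn
      by (intro contour_integral_diff[symmetric] contour_integrable_sum contour_integrable_lmul) auto
    also have "\<dots> = contour_integral ?p (\<lambda>s. of_real x powr (of_nat d - s) * ?E s)"
    proof (rule contour_integral_eq)
      fix s assume "s \<in> path_image ?p"
      then have s: "moran_function N r s \<noteq> 0" using nz L by blast
      have "of_real (r n ^ d) * ?f n s
          = of_real (r n) powr s * (of_real x powr (of_nat d - s) * ?Z s * ?E s)" if "n \<in> {1..N}" for n
      proof -
        have rn: "0 < r n" using r that by blast
        have "complex_of_real x = of_real (r n) * of_real (x / r n)" using rn by simp
        then have "of_real x powr (of_nat d - s)
            = of_real (r n) powr (of_nat d - s) * of_real (x / r n) powr (of_nat d - s)"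
          using rn x by (metis Re_complex_of_real Reals_of_real divide_nonneg_pos less_imp_le powr_times_real)
        moreover have "of_real (r n) powr s * of_real (r n) powr (of_nat d - s) = (of_real (r n ^ d) :: complex)"
          using rn by (simp flip: powr_add)
        ultimately show ?thesis by (simp add: mult.assoc[symmetric])
      qed
      then have "(\<Sum>n = 1..N. of_real (r n ^ d) * ?f n s)
          = (\<Sum>n = 1..N. of_real (r n) powr s) * (of_real x powr (of_nat d - s) * ?Z s * ?E s)"
        unfolding sum_distrib_right by (intro sum.cong refl)
      then have "of_real x powr (of_nat d - s) * ?Z s * ?E s - (\<Sum>n = 1..N. of_real (r n ^ d) * ?f n s)
          = moran_function N r s * ?Z s * (of_real x powr (of_nat d - s) * ?E s)"
        by (simp add: moran_function_def algebra_simps)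
      then show "of_real x powr (of_nat d - s) * ?Z s * ?E s - (\<Sum>n = 1..N. of_real (r n ^ d) * ?f n s)
          = of_real x powr (of_nat d - s) * ?E s"
        using s by (simp add: string_zeta_eq)
    qed
    finally show ?thesis .
  qed
  show "\<exists>K. \<forall>x>0. norm (J x) \<le> K * x powr (real d - \<sigma>)"
  proof -
    have "compact L" using L compact_path_image[of ?p] by simp
    then have "bounded ((\<lambda>s. ?Z s * ?E s) ` L)"
      by (intro compact_imp_bounded compact_continuous_image holomorphic_on_imp_continuous_on hol)
    then obtain B where B: "\<And>s. s \<in> L \<Longrightarrow> norm (?Z s * ?E s) \<le> B"
      by (auto simp: bounded_iff)
    have "norm (J x) \<le> (B * (y1 - y0)) * x powr (real d - \<sigma>)" if x: "0 < x" for x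
    proof -
      have "norm (J x) \<le> (x powr (real d - \<sigma>) * B) * (y1 - y0)"
        unfolding J_def
      proof (rule vertical_integral_bound[OF y])
        have "(\<lambda>s. of_real x powr (of_nat d - s) * (?Z s * ?E s)) holomorphic_on L"
          using x by (intro holomorphic_intros hol) auto
        then show "continuous_on {z. Re z = \<sigma> \<and> y0 \<le> Im z \<and> Im z \<le> y1}
            (\<lambda>s. of_real x powr (of_nat d - s) * ?Z s * ?E s)"
          by (simp add: mult.assoc holomorphic_on_imp_continuous_on L_def)
        fix s assume s: "Re s = \<sigma>" "y0 \<le> Im s" "Im s \<le> y1"
        have "norm (of_real x powr (of_nat d - s) * ?Z s * ?E s) = x powr (real d - \<sigma>) * norm (?Z s * ?E s)"
          using s x by (simp add: norm_mult norm_powr_real_powr)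
        also have "\<dots> \<le> x powr (real d - \<sigma>) * B"
          using B[of s] s by (intro mult_left_mono) (auto simp: L_def)
        finally show "norm (of_real x powr (of_nat d - s) * ?Z s * ?E s) \<le> x powr (real d - \<sigma>) * B" .
      qed
      then show ?thesis by (simp add: mult_ac)
    qed
    then show ?thesis by blast
  qed
qed

lemma norm_diff_div_2pi_i:
  assumes "norm (I - 2 * of_real pi * \<i> * w) \<le> b"
  shows "norm (w - I / (2 * of_real pi * \<i>)) \<le> b"
proof -
  have "w - I / (2 * of_real pi * \<i>) = - ((I - 2 * of_real pi * \<i> * w) / (2 * of_real pi * \<i>))"
    by (simp add: field_simps)
  then have "norm (w - I / (2 * of_real pi * \<i>)) = norm (I - 2 * of_real pi * \<i> * w) / (2 * pi)"
    by (simp add: norm_divide norm_mult)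
  also have "\<dots> \<le> b / 1"
    using assms order_trans[OF norm_ge_zero assms] pi_gt3 by (intro frac_le) auto
  finally show ?thesis by simp
qed

text \<open>The function \<open>V\<close> and the truncated integral with the zeta factor satisfy the same renewal equation
  up to the error \<open>O(1 / R)\<close> of the truncated Mellin inversion of \<open>h\<close>, so their difference is
  \<open>O(1 / R)\<close>.\<close>

lemma renewal_line_integral_approximation:
  fixes \<kappa> :: "nat \<Rightarrow> real" and V h :: "real \<Rightarrow> real"
  assumes r: "\<forall>n\<in>{1..N}. 0 < r n \<and> r n < 1"
    and p: "(\<Sum>n = 1..N. r n ^ d) < 1" and q: "(\<Sum>n = 1..N. r n powr \<sigma>) < 1"
    and g: "0 < g" and \<sigma>: "real d - 1 < \<sigma>" "\<sigma> < real d" and d: "1 \<le> d"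
    and y: "y0 \<le> - R" "R \<le> y1" "y1 - y0 \<le> 3 * R" and R: "2 * real d \<le> R"
    and renewal: "\<And>x. 0 < x \<Longrightarrow> V x = h x + (\<Sum>n = 1..N. r n ^ d * V (x / r n))"
    and bdd: "\<And>x. \<bar>V x\<bar> \<le> K1"
    and small: "\<And>x. 0 < x \<Longrightarrow> x \<le> g \<Longrightarrow> h x = (\<Sum>k<d. \<kappa> k * x ^ (d - k))"
    and large: "\<And>x. g \<le> x \<Longrightarrow> h x = (\<Sum>k<d. \<kappa> k * g ^ (d - k))"
    and x: "0 < x"
  shows "norm (of_real (V x) - contour_integral (vertical_path \<sigma> y0 y1)
      (\<lambda>s. of_real x powr (of_nat d - s) * string_zeta N r s * tube_kernel d g \<kappa> s) / (2 * of_real pi * \<i>))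
    \<le> 20 * (\<Sum>k<d. \<bar>\<kappa> k\<bar> * g powr - real k * real (d - k)) * g powr \<sigma> / R * x powr (real d - \<sigma>)
      / (1 - (\<Sum>n = 1..N. r n powr \<sigma>))"
proof -
  define J where "J x = contour_integral (vertical_path \<sigma> y0 y1)
      (\<lambda>s. of_real x powr (of_nat d - s) * string_zeta N r s * tube_kernel d g \<kappa> s)" for x
  define I where "I x = contour_integral (vertical_path \<sigma> y0 y1)
      (\<lambda>s. of_real x powr (of_nat d - s) * tube_kernel d g \<kappa> s)" for x
  define D where "D x = of_real (V x) - J x / (2 * of_real pi * \<i>)" for x
  define \<eta> where "\<eta> = 20 * (\<Sum>k<d. \<bar>\<kappa> k\<bar> * g powr - real k * real (d - k)) * g powr \<sigma> / R"
  have y01: "y0 < y1" using y R d by linarith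
  note J = zeta_line_integral[OF r q g \<sigma> d y01, where \<kappa>=\<kappa>, folded J_def I_def]
  obtain K2 where K2: "\<And>x. 0 < x \<Longrightarrow> norm (J x) \<le> K2 * x powr (real d - \<sigma>)"
    using J(2) by blast
  have "norm (D x) \<le> \<eta> * x powr (real d - \<sigma>) / (1 - (\<Sum>n = 1..N. r n powr \<sigma>))"
  proof (rule renewal_bound[OF _ p q _ _ x])
    fix x :: real assume x: "0 < x"
    have "norm (I x - 2 * pi * \<i> * of_real (h x)) \<le> \<eta> * x powr (real d - \<sigma>)"
    proof (cases "x \<le> g")
      case True
      then show ?thesis
        using tube_integral_small[OF x True g d \<sigma> y R, of \<kappa>] small[OF x True]
        by (simp add: I_def \<eta>_def mult_ac)
    next
      case False
      then have "g \<le> x" by simp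
      then show ?thesis
        using tube_integral_large[OF \<open>g \<le> x\<close> g d \<sigma> y R, of \<kappa>] large[OF \<open>g \<le> x\<close>]
        by (simp add: I_def \<eta>_def mult_ac)
    qed
    then have "norm (of_real (h x) - I x / (2 * of_real pi * \<i>)) \<le> \<eta> * x powr (real d - \<sigma>)"
      by (intro norm_diff_div_2pi_i) simp
    moreover have "D x - (\<Sum>n = 1..N. of_real (r n ^ d) * D (x / r n))
        = of_real (V x - (\<Sum>n = 1..N. r n ^ d * V (x / r n)))
          - (J x - (\<Sum>n = 1..N. of_real (r n ^ d) * J (x / r n))) / (2 * of_real pi * \<i>)"
      unfolding D_def by (simp add: algebra_simps sum_subtractf diff_divide_distrib sum_divide_distrib)
    moreover have "V x - (\<Sum>n = 1..N. r n ^ d * V (x / r n)) = h x" using renewal[OF x] by simp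
    ultimately show "norm (D x - (\<Sum>n = 1..N. of_real (r n ^ d) * D (x / r n))) \<le> \<eta> * x powr (real d - \<sigma>)"
      using J(1)[OF x] by (simp only:)
    have "norm (J x / (2 * of_real pi * \<i>)) \<le> norm (J x) / 1"
      unfolding norm_divide using pi_gt3 by (intro divide_left_mono) (auto simp: norm_mult)
    then have "norm (J x / (2 * of_real pi * \<i>)) \<le> K2 * x powr (real d - \<sigma>)"
      using K2[OF x] by simp
    moreover have "norm (complex_of_real (V x)) \<le> K1" using bdd by simp
    ultimately show "norm (D x) \<le> K1 + K2 * x powr (real d - \<sigma>)"
      unfolding D_def using norm_triangle_ineq4[of "of_real (V x)" "J x / (2 * of_real pi * \<i>)"] by linarith
  qed (use r in auto)
  then show ?thesis by (simp add: D_def J_def \<eta>_def)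
qed

lemma languid_sequence_eventually:
  assumes "languid_sequence N r T"
  defines "R \<equiv> \<lambda>n::nat. min (T (int n)) (- T (- int n))"
  shows "filterlim R at_top sequentially"
    and "eventually (\<lambda>n. T (- int n) \<le> - R n \<and> R n \<le> T (int n) \<and> T (int n) - T (- int n) \<le> 3 * R n) sequentially"
proof -
  have T: "filterlim (\<lambda>n. T (int n)) at_top sequentially" "filterlim (\<lambda>n. - T (- int n)) at_top sequentially"
    using assms(1) by (auto simp: languid_sequence_def filterlim_uminus_at_top)
  show "filterlim R at_top sequentially"
    unfolding filterlim_at_top
  proof
    fix b
    show "eventually (\<lambda>n. b \<le> R n) sequentially"
      using T[unfolded filterlim_at_top, rule_format, of b] by eventually_elim (simp add: R_def)
  qed
  have "(\<lambda>n. T (int n) / \<bar>T (- int n)\<bar>) \<longlonglongrightarrow> 1" using assms(1) by (simp add: languid_sequence_def)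
  then have "eventually (\<lambda>n. 1 / 2 < T (int n) / \<bar>T (- int n)\<bar>) sequentially"
    "eventually (\<lambda>n. T (int n) / \<bar>T (- int n)\<bar> < 2) sequentially"
    by (rule order_tendstoD; simp)+
  moreover have "eventually (\<lambda>n. n \<ge> 1) sequentially" by (rule eventually_ge_at_top)
  ultimately show "eventually (\<lambda>n. T (- int n) \<le> - R n \<and> R n \<le> T (int n) \<and> T (int n) - T (- int n) \<le> 3 * R n) sequentially"
  proof eventually_elim
    case (elim n)
    have "T (- int n) < 0" "0 < T (int n)" using assms(1) elim(3) by (auto simp: languid_sequence_def)
    then show ?case using elim by (auto simp: R_def field_simps min_def)
  qed
qed


text \<open>Here \<open>V\<close> is any bounded solution of the renewal equation with the inhomogeneity \<open>h\<close> of a monophase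
  generator.  The truncated integral over the segment from \<open>T (- n)\<close> to \<open>T n\<close> is close to \<open>V x\<close> by
  the renewal inequality, and close to the sum of the residues by shifting the contour to the
  left.\<close>

lemma renewal_strip_sum:
  fixes \<kappa> :: "nat \<Rightarrow> real" and V h :: "real \<Rightarrow> real"
  assumes N: "1 \<le> N" and r: "\<forall>n\<in>{1..N}. 0 < r n \<and> r n < 1"
    and p: "(\<Sum>n = 1..N. r n ^ d) < 1" and g: "0 < g" and d: "1 \<le> d"
    and simple: "tubular_poles_simple N r d" and languid: "languid_sequence N r T"
    and renewal: "\<And>x. 0 < x \<Longrightarrow> V x = h x + (\<Sum>n = 1..N. r n ^ d * V (x / r n))"
    and bdd: "\<And>x. \<bar>V x\<bar> \<le> K1"
    and small: "\<And>x. 0 < x \<Longrightarrow> x \<le> g \<Longrightarrow> h x = (\<Sum>k<d. \<kappa> k * x ^ (d - k))"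
    and large: "\<And>x. g \<le> x \<Longrightarrow> h x = (\<Sum>k<d. \<kappa> k * g ^ (d - k))"
    and x: "0 < x" "x \<le> g"
  shows "has_strip_sum T
    (\<lambda>\<omega>. residue (string_zeta N r) \<omega> * of_real x powr (of_nat d - \<omega>) * tube_kernel d g \<kappa> \<omega>)
    (string_poles N r)
    (of_real (V x) - (\<Sum>k<d. of_real (\<kappa> k) * string_zeta N r (of_nat k) * of_real x ^ (d - k)))"
proof -
  let ?Z = "string_zeta N r" and ?E = "tube_kernel d g \<kappa>"
  have rpos: "\<forall>n\<in>{1..N}. 0 < r n" using r by blast
  obtain \<sigma> where \<sigma>: "real d - 1 < \<sigma>" "\<sigma> < real d" and q: "(\<Sum>n = 1..N. r n powr \<sigma>) < 1"
    using exists_contraction_exponent[of N r d] rpos p by blast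
  obtain L where L: "\<And>s. Re s \<le> L \<Longrightarrow> 1 \<le> norm (moran_function N r s)"
    using moran_function_lower_bound_left[OF r N] by blast
  obtain c where c: "\<And>n \<alpha>. norm (?Z (Complex \<alpha> (T n))) \<le> c"
    using languid unfolding languid_sequence_def by blast
  have poles: "string_poles N r = {\<omega>. moran_function N r \<omega> = 0}"
    by (rule string_poles_eq[OF r N q])
  have finZ: "finite {\<omega>\<in>string_poles N r. a \<le> Im \<omega> \<and> Im \<omega> \<le> b}" for a b
    using finite_moran_zeros[OF r N q, of a b] by (simp add: poles)
  define M where "M = max 1 c"
  define R where "R n = min (T (int n)) (- T (- int n))" for n :: nat
  define P where "P n = {\<omega> \<in> string_poles N r. T (- int n) < Im \<omega> \<and> Im \<omega> < T (int n)}" for n :: nat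
  define Q where "Q = (\<Sum>k<d. of_real (\<kappa> k) * ?Z (of_nat k) * of_real x ^ (d - k))"
  define S where "S n = (\<Sum>\<omega>\<in>P n. residue ?Z \<omega> * of_real x powr (of_nat d - \<omega>) * ?E \<omega>)" for n
  define C where "C = 20 * (\<Sum>k<d. \<bar>\<kappa> k\<bar> * g powr - real k * real (d - k)) * g powr \<sigma> * x powr (real d - \<sigma>)"
  have finP: "finite (P n)" for n
    by (rule finite_subset[OF _ finZ[of "T (- int n)" "T (int n)"]]) (auto simp: P_def)
  have Rlim: "filterlim R at_top sequentially"
    and Rev: "eventually (\<lambda>n. T (- int n) \<le> - R n \<and> R n \<le> T (int n) \<and> T (int n) - T (- int n) \<le> 3 * R n) sequentially"
    using languid_sequence_eventually[OF languid] by (simp_all add: R_def[abs_def])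
  have "eventually (\<lambda>n. max (2 * real d) (\<sigma> - L) \<le> R n) sequentially"
    using Rlim unfolding filterlim_at_top by blast
  with Rev have close: "eventually (\<lambda>n. norm (S n - (of_real (V x) - Q))
      \<le> (C / (1 - (\<Sum>n = 1..N. r n powr \<sigma>)) + M * C) / R n) sequentially"
  proof eventually_elim
    case (elim n)
    let ?y0 = "T (- int n)" and ?y1 = "T (int n)"
    let ?J = "contour_integral (vertical_path \<sigma> ?y0 ?y1)
      (\<lambda>s. of_real x powr (of_nat d - s) * ?Z s * ?E s)"
    have y: "?y0 \<le> - R n" "R n \<le> ?y1" "?y1 - ?y0 \<le> 3 * R n" and R: "2 * real d \<le> R n" "\<sigma> - R n \<le> L"
      using elim by auto
    have R0: "0 < R n" using R d by linarith
    \<comment> \<open>All poles in a strip slightly larger than the rectangle, as required for holomorphy on a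
      neighbourhood of its horizontal sides.\<close>
    define Z where "Z = {\<omega>\<in>string_poles N r. ?y0 - 1 \<le> Im \<omega> \<and> Im \<omega> \<le> ?y1 + 1}"
    have far: "norm (of_real (V x) - ?J / (2 * of_real pi * \<i>)) \<le> C / (1 - (\<Sum>n = 1..N. r n powr \<sigma>)) / R n"
      using renewal_line_integral_approximation[OF r p q g \<sigma> d y R(1) renewal bdd small large x(1)]
      by (simp add: C_def mult_ac)
    have "norm (?J - 2 * pi * \<i> * ((\<Sum>k<d. of_real (\<kappa> k) * ?Z (of_nat k) * of_real x ^ (d - k))
         + (\<Sum>\<omega> | \<omega> \<in> Z \<and> ?y0 < Im \<omega> \<and> Im \<omega> < ?y1. residue ?Z \<omega> * of_real x powr (of_nat d - \<omega>) * ?E \<omega>)))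
      \<le> 20 * M * (\<Sum>k<d. \<bar>\<kappa> k\<bar> * g powr - real k * real (d - k)) * g powr \<sigma> * x powr (real d - \<sigma>) / R n"
    proof (rule tube_integral_shift_left[OF x g d \<sigma> y R(1)])
      show "finite Z" unfolding Z_def by (rule finZ)
      show "Z \<inter> of_nat ` {..d} = {}"
        using simple by (auto simp: Z_def tubular_poles_simple_def atMost_atLeast0)
      show "?Z holomorphic_on {s. ?y0 - 1 < Im s \<and> Im s < ?y1 + 1} - Z"
        by (rule string_zeta_holomorphic[OF rpos]) (auto simp: Z_def poles)
    next
      fix \<omega> assume \<omega>: "\<omega> \<in> Z" "?y0 \<le> Im \<omega>" "Im \<omega> \<le> ?y1"
      then have zero: "moran_function N r \<omega> = 0" by (simp add: Z_def poles)
      have "\<not> Re \<omega> \<le> L" using L[of \<omega>] zero by auto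
      moreover have "Re \<omega> < \<sigma>" using moran_zero_Re_less[OF r N q zero] .
      moreover have "moran_function N r (Complex (Re \<omega>) (T m)) \<noteq> 0" for m
        by (rule languid_no_pole[OF r q c])
      then have "Im \<omega> \<noteq> T m" for m using zero by (metis complex.collapse)
      then have "Im \<omega> \<noteq> ?y0" "Im \<omega> \<noteq> ?y1" by blast+
      ultimately show "\<sigma> - R n < Re \<omega> \<and> Re \<omega> < \<sigma> \<and> ?y0 < Im \<omega> \<and> Im \<omega> < ?y1"
        using \<omega>(2,3) R(2) by linarith
    next
      fix \<omega> assume "\<omega> \<in> Z"
      then have "is_pole ?Z \<omega>" "zorder ?Z \<omega> = -1"
        using simple by (auto simp: Z_def tubular_poles_simple_def string_poles_def)
      moreover have "isolated_singularity_at ?Z \<omega>"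
      proof (rule meromorphic_on_isolated_singularity)
        have "?Z meromorphic_on UNIV" using rpos by (intro string_zeta_meromorphic) auto
        then show "?Z meromorphic_on {\<omega>}" by (rule meromorphic_on_subset) simp
      qed
      ultimately show "((\<lambda>s. ?Z s * (s - \<omega>)) \<longlongrightarrow> residue ?Z \<omega>) (at \<omega>)"
        by (intro simple_pole_limit)
    next
      fix s assume "Im s = ?y0 \<or> Im s = ?y1 \<or> Re s = \<sigma> - R n"
      then show "norm (?Z s) \<le> M"
      proof (elim disjE)
        assume "Re s = \<sigma> - R n"
        then have "1 \<le> norm (moran_function N r s)" using R(2) by (intro L) simp
        then have "norm (?Z s) \<le> 1" by (simp add: string_zeta_eq norm_divide divide_le_eq)
        then show ?thesis by (simp add: M_def)
      next
        assume "Im s = ?y0"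
        then show ?thesis using c[of "Re s" "- int n"] complex.collapse[of s] by (simp add: M_def)
      next
        assume "Im s = ?y1"
        then show ?thesis using c[of "Re s" "int n"] complex.collapse[of s] by (simp add: M_def)
      qed
    qed
    moreover have "{\<omega>. \<omega> \<in> Z \<and> ?y0 < Im \<omega> \<and> Im \<omega> < ?y1} = P n" by (auto simp: Z_def P_def)
    ultimately have "norm (?J - 2 * of_real pi * \<i> * (Q + S n)) \<le> M * C / R n"
      by (simp add: Q_def S_def C_def mult_ac)
    then have near: "norm ((Q + S n) - ?J / (2 * of_real pi * \<i>)) \<le> M * C / R n"
      by (rule norm_diff_div_2pi_i)
    have "S n - (of_real (V x) - Q) = ((Q + S n) - ?J / (2 * of_real pi * \<i>))
        - (of_real (V x) - ?J / (2 * of_real pi * \<i>))" by simp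
    also have "norm \<dots> \<le> M * C / R n + C / (1 - (\<Sum>n = 1..N. r n powr \<sigma>)) / R n"
      by (rule order_trans[OF norm_triangle_ineq4 add_mono[OF near far]])
    finally show ?case by (simp add: add_divide_distrib add.commute)
  qed
  have "(\<lambda>n. (C / (1 - (\<Sum>n = 1..N. r n powr \<sigma>)) + M * C) / R n) \<longlonglongrightarrow> 0"
    by (rule real_tendsto_divide_at_top[OF tendsto_const Rlim])
  then have "(\<lambda>n. S n - (of_real (V x) - Q)) \<longlonglongrightarrow> 0"
    using close by (rule Lim_null_comparison[rotated])
  then have "S \<longlonglongrightarrow> of_real (V x) - Q" by (simp add: LIM_zero_iff)
  then show ?thesis
    using finP unfolding has_strip_sum_def S_def P_def Q_def by simp
qed

lemma has_strip_sum_cong: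
  assumes "\<And>\<omega>. \<omega> \<in> A \<Longrightarrow> f \<omega> = f' \<omega>" "has_strip_sum T f A S"
  shows "has_strip_sum T f' A S"
proof -
  have "(\<Sum>\<omega> | \<omega> \<in> A \<and> T (- int n) < Im \<omega> \<and> Im \<omega> < T (int n). f \<omega>)
      = (\<Sum>\<omega> | \<omega> \<in> A \<and> T (- int n) < Im \<omega> \<and> Im \<omega> < T (int n). f' \<omega>)" for n
    by (rule sum.cong) (use assms(1) in auto)
  then show ?thesis using assms(2) by (simp add: has_strip_sum_def)
qed

lemma has_strip_sum_Un_finite_real:
  assumes S: "has_strip_sum T f A S" and B: "finite B" "A \<inter> B = {}" "\<And>\<omega>. \<omega> \<in> B \<Longrightarrow> Im \<omega> = 0"
    and T: "\<And>n. 1 \<le> n \<Longrightarrow> T (- n) < 0 \<and> 0 < T n"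
  shows "has_strip_sum T f (A \<union> B) (S + sum f B)"
proof -
  let ?A = "\<lambda>A n. {\<omega> \<in> A. T (- int n) < Im \<omega> \<and> Im \<omega> < T (int n)}"
  have Un: "?A (A \<union> B) n = ?A A n \<union> ?A B n" for n by auto
  have fin: "finite (?A A n)" "finite (?A B n)" for n
    using S B(1) by (auto simp: has_strip_sum_def)
  have "(\<lambda>n. sum f (?A A n) + sum f B) \<longlonglongrightarrow> S + sum f B"
    using S by (intro tendsto_intros) (simp add: has_strip_sum_def)
  moreover have "eventually (\<lambda>n. sum f (?A A n) + sum f B = sum f (?A (A \<union> B) n)) sequentially"
    using eventually_ge_at_top[of 1]
  proof eventually_elim
    case (elim n)
    then have "?A B n = B" using B(3) T[of "int n"] by auto
    then show ?case using fin[of n] B(2) unfolding Un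
      by (subst sum.union_disjoint) auto
  qed
  ultimately have "(\<lambda>n. sum f (?A (A \<union> B) n)) \<longlonglongrightarrow> S + sum f B"
    by (rule Lim_transform_eventually)
  moreover have "finite (?A (A \<union> B) n)" for n unfolding Un using fin by simp
  ultimately show ?thesis unfolding has_strip_sum_def by blast
qed

theorem corollary5p10:
  fixes \<Phi> :: "nat \<Rightarrow> 'a::euclidean_space \<Rightarrow> 'a"
    and N :: nat and r :: "nat \<Rightarrow> real" and U G :: "'a set"
    and g \<epsilon> :: real and \<kappa> :: "nat \<Rightarrow> real" and T :: "int \<Rightarrow> real"
    and d :: nat and c :: "complex \<Rightarrow> complex"
  assumes "d = DIM('a)"
    and "contractive_similarities N \<Phi> r"
    and "feasible_open_set N \<Phi> U"
    and "nontriviality_condition N \<Phi>"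
    and "generators N \<Phi> U = {G}"
    and "g = inradius G"
    and "monophase_with G \<kappa>"
    and "tubular_poles_simple N r d"
    and "languid_sequence N r T"
    and "\<And>\<omega>. \<omega> \<in> string_poles N r \<Longrightarrow>
           c \<omega> = residue (string_zeta N r) \<omega> / (of_nat d - \<omega>) *
             (\<Sum>k = 0..d - 1. of_real g powr (\<omega> - of_nat k) * of_nat (d - k) / (\<omega> - of_nat k)
                * of_real (\<kappa> k))"
    and "\<And>k. k \<in> {0..d} \<Longrightarrow> c (of_nat k) = of_real (\<kappa> k) * string_zeta N r (of_nat k)"
    and "0 < \<epsilon>" and "\<epsilon> < g"
  shows "(\<exists>S. has_strip_sum T (\<lambda>\<omega>. c \<omega> * of_real \<epsilon> powr (of_nat d - \<omega>)) (string_poles N r) S \<and>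
           of_real (tiling_volume (self_similar_tiling N \<Phi> U) \<epsilon>) =
             S + (\<Sum>k = 0..d. c (of_nat k) * of_real \<epsilon> ^ (d - k)))
       \<and> has_strip_sum T (\<lambda>\<omega>. c \<omega> * of_real \<epsilon> powr (of_nat d - \<omega>)) (tubular_poles N r d)
           (of_real (tiling_volume (self_similar_tiling N \<Phi> U) \<epsilon>))"
proof -
  let ?V = "tiling_volume (self_similar_tiling N \<Phi> U)"
  let ?f = "\<lambda>\<omega>. c \<omega> * of_real \<epsilon> powr (of_nat d - \<omega>)"
  note dim = assms(1) and sim = assms(2) and feas = assms(3) and gen = assms(5)
    and mono = assms(7) and simple = assms(8)
  have r: "\<forall>n\<in>{1..N}. 0 < r n \<and> r n < 1" and N: "1 \<le> N"
    using sim by (auto simp: contractive_similarities_def)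
  have d: "1 \<le> d" by (simp add: dim Suc_leI)
  have g: "0 < g" using assms(12,13) by simp
  note facts = self_similar_tiling_facts[OF sim feas gen]
  have "bounded U" using feas by (simp add: feasible_open_set_def)
  then have "bounded G" by (subst facts(1)) (rule bounded_diff)
  note G = facts(2) this
  have \<kappa>d: "\<kappa> d = 0"
    using monophase_top_coefficient[OF G _ mono] g assms(6) dim by simp
  have split: "(\<Sum>k = 0..d. a k) = (\<Sum>k<d. a k) + a d" for a :: "nat \<Rightarrow> 'b::comm_monoid_add"
    by (simp add: atLeast0AtMost lessThan_Suc_atMost[symmetric])
  have small: "inner_volume G y = (\<Sum>k<d. \<kappa> k * y ^ (d - k))" if "0 < y" "y \<le> g" for y
    using mono that split[of "\<lambda>k. \<kappa> k * y ^ (d - k)"] \<kappa>d assms(6) dim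
    by (simp add: monophase_with_def)
  \<comment> \<open>Beyond the inradius the inner parallel set is all of \<open>G\<close>, so the polynomial at \<open>g\<close> gives the
    volume of \<open>G\<close>.\<close>
  have large: "inner_volume G y = (\<Sum>k<d. \<kappa> k * g ^ (d - k))" if "g \<le> y" for y
  proof -
    have "inner_volume G y = inner_volume G g"
      using inner_volume_ge_inradius[OF G] that assms(6) by simp
    then show ?thesis using small[of g] g by simp
  qed
  have "has_strip_sum T
    (\<lambda>\<omega>. residue (string_zeta N r) \<omega> * of_real \<epsilon> powr (of_nat d - \<omega>) * tube_kernel d g \<kappa> \<omega>)
    (string_poles N r)
    (of_real (?V \<epsilon>) - (\<Sum>k<d. of_real (\<kappa> k) * string_zeta N r (of_nat k) * of_real \<epsilon> ^ (d - k)))"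
  proof (rule renewal_strip_sum[OF N r _ g d simple assms(9)])
    show "(\<Sum>n = 1..N. r n ^ d) < 1" using sum_ratio_power_less_1[OF sim feas gen] by (simp add: dim)
    show "?V y = inner_volume G y + (\<Sum>n = 1..N. r n ^ d * ?V (y / r n))" for y
      unfolding dim by (rule tiling_volume_unfold[OF sim feas gen])
    show "\<bar>?V y\<bar> \<le> measure lebesgue U" for y by (rule tiling_volume_bounds[OF sim feas gen])
  qed (use small large assms(12,13) in auto)
  then have poles: "has_strip_sum T ?f (string_poles N r)
    (of_real (?V \<epsilon>) - (\<Sum>k<d. of_real (\<kappa> k) * string_zeta N r (of_nat k) * of_real \<epsilon> ^ (d - k)))"
  proof (rule has_strip_sum_cong[rotated])
    fix \<omega> assume \<omega>: "\<omega> \<in> string_poles N r"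
    have "{0..d - 1} = {..<d}" using d by auto
    then show "residue (string_zeta N r) \<omega> * of_real \<epsilon> powr (of_nat d - \<omega>) * tube_kernel d g \<kappa> \<omega> = ?f \<omega>"
      unfolding assms(10)[OF \<omega>] tube_kernel_def
      by (simp add: sum_distrib_left sum_distrib_right mult_ac)
  qed
  have ck: "c (of_nat k) = of_real (\<kappa> k) * string_zeta N r (of_nat k)" if "k \<le> d" for k
    using assms(11) that by simp
  have Q: "(\<Sum>k<d. of_real (\<kappa> k) * string_zeta N r (of_nat k) * of_real \<epsilon> ^ (d - k))
      = (\<Sum>k = 0..d. c (of_nat k) * of_real \<epsilon> ^ (d - k))"
    by (simp add: split ck \<kappa>d)
  have "sum ?f (of_nat ` {0..d}) = (\<Sum>k = 0..d. ?f (of_nat k))"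
    by (subst sum.reindex) (auto simp: inj_on_def)
  also have "\<dots> = (\<Sum>k = 0..d. c (of_nat k) * of_real \<epsilon> ^ (d - k))"
  proof (rule sum.cong[OF refl])
    fix k assume "k \<in> {0..d}"
    then show "?f (of_nat k) = c (of_nat k) * of_real \<epsilon> ^ (d - k)"
      using assms(12) by (metis atLeastAtMost_iff of_nat_diff of_real_eq_0_iff order_less_irrefl powr_complexpow)
  qed
  finally have int: "sum ?f (of_nat ` {0..d}) = (\<Sum>k = 0..d. c (of_nat k) * of_real \<epsilon> ^ (d - k))" .
  have "has_strip_sum T ?f (string_poles N r \<union> of_nat ` {0..d})
    ((of_real (?V \<epsilon>) - (\<Sum>k = 0..d. c (of_nat k) * of_real \<epsilon> ^ (d - k))) + sum ?f (of_nat ` {0..d}))"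
  proof (rule has_strip_sum_Un_finite_real[OF poles[unfolded Q]])
    show "string_poles N r \<inter> of_nat ` {0..d} = {}"
      using simple by (simp add: tubular_poles_simple_def)
    show "T (- n) < 0 \<and> 0 < T n" if "1 \<le> n" for n
      using assms(9) that by (simp add: languid_sequence_def)
  qed auto
  then have "has_strip_sum T ?f (tubular_poles N r d) (of_real (?V \<epsilon>))"
    by (simp add: int tubular_poles_def)
  moreover have "of_real (?V \<epsilon>) = (of_real (?V \<epsilon>) - (\<Sum>k = 0..d. c (of_nat k) * of_real \<epsilon> ^ (d - k)))
      + (\<Sum>k = 0..d. c (of_nat k) * of_real \<epsilon> ^ (d - k))" by simp
  ultimately show ?thesis using poles[unfolded Q] by blast
qed

end
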